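(* Assume that the system $g(p,x)\in C$ enjoys Robinson stability at $(\bar p,\bar x)$, and that strict complementarity holds for the system $g(\bar p,x)\in C$ at $(\bar x,\bar x^* )$. Then for every $v=(q,u)\in{\cal P}\times X$, $$D\Psi(\bar p,\bar x,\bar x^* )(v)\subset\bigcup\Big\{\big(\nabla(\nabla_xg(\cdot)^*\hat\lambda)(\bar z)+{\cal H}_{\hat\lambda}\big)v+\pi_{X^*}\big(N_{{\cal K}_{\operatorname{gph}\Gamma}(\bar z,z^* )}(v)\big)\ \Big|\ z^*\in N_{T_{\operatorname{gph}\Gamma}(\bar z)}(v),\ \pi_{X^*}(z^* )=\bar x^*,\ \hat\lambda\in\Lambda(\bar z,z^* )\Big\}.$$ This inclusion holds as an equality if in addition $$\nabla h(g(\bar z))\nabla^2g(\bar z)(v,v)+\nabla^2h(g(\bar z))\big(\nabla g(\bar z)v,\nabla g(\bar z)v\big)\in\operatorname{rge}\big(\nabla h(g(\bar z))\circ\nabla g(\bar z)\big)+\operatorname{lin}K,$$ which is satisfied in particular when $\nabla g(\bar z)$ is surjective.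
   Context: Notation: $X=\mathbb R^n$, $P=\mathbb R^m$, $Y=\mathbb R^l$, $Z:=P\times X$, and $E$ is finite-dimensional. Dual spaces are distinguished from primal ones, $Z^*=P^*\times X^*$, and $\pi_{X^*}(p^*,x^* ):=x^*$. $A^*$ denotes the adjoint of a linear map $A$, and $\operatorname{rge}A$ its range. For $\lambda\in Y^*$, $\nabla(\nabla_xg(\cdot)^*\lambda)(\bar z)v\in X^*$ is the derivative at $\bar z$ of $z\mapsto\nabla_xg(z)^*\lambda$, applied to $v$. For a cone $A$, $A^*:=\{a^*:\langle a^*,a\rangle\le0\ \forall a\in A\}$ is its polar, and for a closed convex cone $K$, $\operatorname{lin}K:=K\cap(-K)$; $\operatorname{ri}$ is the relative interior. For a closed set $\Omega$ and $\bar z\in\Omega$: the tangent cone is $T_\Omega(\bar z):=\{w:\exists\, t_k\downarrow0,\ w_k\to w \text{ with } \bar z+t_kw_k\in\Omega\}$; the regular normal cone is $N_\Omega(\bar z):=\{z^*:\limsup_{z\to\bar z,\,z\in\Omega}\langle z^*,z-\bar z\rangle/\|z-\bar z\|\le0\}$ (for convex sets, this is the normal cone of convex analysis); and, for $z^*\in N_\Omega(\bar z)$, the critical cone is ${\cal K}_\Omega(\bar z,z^* ):=T_\Omega(\bar z)\cap\{z^*\}^\perp$. For a set-valued map $\Phi$, the graphical derivative is $D\Phi(\bar z,\bar u)(w):=\{v:(w,v)\in T_{\operatorname{gph}\Phi}(\bar z,\bar u)\}$. Setting: $g\colon P\times X\to Y$ is $C^2$ around $\bar z=(\bar p,\bar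 x)$. The set $C\subset Y$ is closed and $C^2$-cone reducible at $g(\bar z)$ to a closed convex cone $K\subset E$: there exist a neighborhood $V$ of $g(\bar z)$ and a $C^2$ map $h\colon V\to E$ with $h(g(\bar z))=0$, $\nabla h(g(\bar z))$ surjective, and $C\cap V=\{y\in V:h(y)\in K\}$. Set $\Gamma(p):=\{x:g(p,x)\in C\}$ with $\bar x\in\Gamma(\bar p)$, $\Psi(p,x):=N_{\Gamma(p)}(x)$, and fix $\bar x^*\in N_{\Gamma(\bar p)}(\bar x)$. Let $G:=h\circ g$ near $\bar z$. The system $g(p,x)\in C$ enjoys Robinson stability at $(\bar p,\bar x)$ if there are $\kappa\ge0$ and neighborhoods $W$ of $\bar p$ and $U$ of $\bar x$ with ${\rm dist}(x;\Gamma(p))\le\kappa\,{\rm dist}(g(p,x);C)$ for all $(p,x)\in W\times U$. Strict complementarity holds for $g(\bar p,x)\in C$ at $(\bar x,\bar x^* )$ if there is $\lambda\in\operatorname{ri}N_C(g(\bar z))$ with $\nabla_xg(\bar z)^*\lambda=\bar x^*$. The characteristic subspace is ${\cal P}:=\{q\in P:\nabla_pG(\bar z)q\in\operatorname{rge}\nabla_xG(\bar z)+\operatorname{lin}K\}$; equivalently, ${\cal P}=\{q:\nabla_pg(\bar z)q\in\operatorname{rge}\nabla_xg(\bar z)+\operatorname{lin}T_C(g(\bar z))\}$. Multipliers: for $\lambda\in N_C(g(\bar z))$, let $(\nabla h(g(\bar z))^* )^{-1}\lambda$ denote the unique $\mu\in E^*$ with $\nabla h(g(\bar z))^*\mu=\lambda$.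 For $z^*\in N_{\operatorname{gph}\Gamma}(\bar z)$, set $\Lambda(\bar z,z^* ):=\{\lambda\in N_C(g(\bar z)):\nabla g(\bar z)^*\lambda=z^*\}$. For $\lambda\in N_C(g(\bar z))$, the linear map ${\cal H}_\lambda\colon Z\to X^*$ is ${\cal H}_\lambda v:=\nabla_xg(\bar z)^*\nabla^2\langle(\nabla h(g(\bar z))^* )^{-1}\lambda,h(\cdot)\rangle(g(\bar z))\nabla g(\bar z)v$, where $\nabla^2\langle\mu,h(\cdot)\rangle(y)$ is the Hessian of $y\mapsto\langle\mu,h(y)\rangle$, viewed as a linear map $Y\to Y^*$. *)

theory Defs
  imports "HOL-Analysis.Analysis"
begin

text \<open>Dual spaces are identified with the primal Euclidean spaces via the inner product.\<close>

definition tangent_cone :: "'a::real_normed_vector set \<Rightarrow> 'a \<Rightarrow> 'a set" where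
  "tangent_cone S z = {w. \<exists>t wk. (\<forall>k. t k > 0) \<and> t \<longlonglongrightarrow> 0 \<and> wk \<longlonglongrightarrow> w
      \<and> (\<forall>k. z + t k *\<^sub>R wk k \<in> S)}"

definition normal_cone :: "'a::real_inner set \<Rightarrow> 'a \<Rightarrow> 'a set" where
  "normal_cone S z = {v. z \<in> S \<and> (\<forall>e>0. \<exists>d>0. \<forall>z'\<in>S. norm (z' - z) < d \<longrightarrow>
      inner v (z' - z) \<le> e * norm (z' - z))}"

definition critical_cone :: "'a::real_inner set \<Rightarrow> 'a \<Rightarrow> 'a \<Rightarrow> 'a set" where
  "critical_cone S z zs = tangent_cone S z \<inter> {w. inner zs w = 0}"

definition lin_space :: "'a::real_vector set \<Rightarrow> 'a set" where
  "lin_space K = K \<inter> uminus ` K"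

definition set_plus :: "'a::plus set \<Rightarrow> 'a set \<Rightarrow> 'a set" where
  "set_plus A B = {a + b | a b. a \<in> A \<and> b \<in> B}"

definition gph :: "('a \<Rightarrow> 'b set) \<Rightarrow> ('a \<times> 'b) set" where
  "gph F = {(z, u). u \<in> F z}"

definition graph_deriv :: "('a::real_normed_vector \<Rightarrow> 'b::real_normed_vector set)
    \<Rightarrow> 'a \<Rightarrow> 'b \<Rightarrow> 'a \<Rightarrow> 'b set" where
  "graph_deriv F z u w = {v. (w, v) \<in> tangent_cone (gph F) (z, u)}"

definition Dbl :: "('a::euclidean_space \<Rightarrow> 'b::euclidean_space) \<Rightarrow> 'a \<Rightarrow> 'a \<Rightarrow>\<^sub>L 'b" where
  "Dbl f w = Blinfun (frechet_derivative f (at w))"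

definition C2_near :: "('a::euclidean_space \<Rightarrow> 'b::euclidean_space) \<Rightarrow> 'a \<Rightarrow> bool" where
  "C2_near f a \<longleftrightarrow> (\<exists>U. open U \<and> a \<in> U \<and> (\<forall>w\<in>U. f differentiable at w)
     \<and> (\<forall>w\<in>U. Dbl f differentiable at w)
     \<and> continuous_on U (\<lambda>w. Blinfun (frechet_derivative (Dbl f) (at w))))"

definition d2 :: "('a::real_normed_vector \<Rightarrow> 'b::real_normed_vector) \<Rightarrow> 'a \<Rightarrow> 'a \<Rightarrow> 'a \<Rightarrow> 'b" where
  "d2 f a v w = frechet_derivative (\<lambda>z. frechet_derivative f (at z) v) (at a) w"

definition Dp :: "('p::real_normed_vector \<times> 'x::real_normed_vector \<Rightarrow> 'y::real_normed_vector)
    \<Rightarrow> 'p \<times> 'x \<Rightarrow> 'p \<Rightarrow> 'y" where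
  "Dp g z q = frechet_derivative g (at z) (q, 0)"

definition Dx :: "('p::real_normed_vector \<times> 'x::real_normed_vector \<Rightarrow> 'y::real_normed_vector)
    \<Rightarrow> 'p \<times> 'x \<Rightarrow> 'x \<Rightarrow> 'y" where
  "Dx g z u = frechet_derivative g (at z) (0, u)"

definition cone_reducible ::
  "('y::euclidean_space) set \<Rightarrow> 'y \<Rightarrow> ('y \<Rightarrow> 'e::euclidean_space) \<Rightarrow> 'e set \<Rightarrow> bool" where
  "cone_reducible C y0 h K \<longleftrightarrow> closed K \<and> convex K \<and> cone K \<and>
     (\<exists>V. open V \<and> y0 \<in> V \<and> C2_near h y0 \<and> h y0 = 0 \<and> surj (frechet_derivative h (at y0))
        \<and> C \<inter> V = {y\<in>V. h y \<in> K})"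

definition Gamma :: "('p \<times> 'x \<Rightarrow> 'y) \<Rightarrow> 'y set \<Rightarrow> 'p \<Rightarrow> 'x set" where
  "Gamma g C p = {x. g (p, x) \<in> C}"

definition Psi :: "('p \<times> 'x \<Rightarrow> 'y) \<Rightarrow> 'y set \<Rightarrow> 'p \<times> 'x \<Rightarrow> ('x::real_inner) set" where
  "Psi g C z = normal_cone (Gamma g C (fst z)) (snd z)"

definition robinson_stable ::
  "('p::real_normed_vector \<times> 'x::real_normed_vector \<Rightarrow> 'y::real_normed_vector) \<Rightarrow> 'y set \<Rightarrow> 'p \<Rightarrow> 'x \<Rightarrow> bool" where
  "robinson_stable g C pb xb \<longleftrightarrow> (\<exists>\<kappa>\<ge>0. \<exists>W U. open W \<and> pb \<in> W \<and> open U \<and> xb \<in> U \<and>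
     (\<forall>p\<in>W. \<forall>x\<in>U. Gamma g C p \<noteq> {} \<and> infdist x (Gamma g C p) \<le> \<kappa> * infdist (g (p, x)) C))"

definition strict_compl ::
  "('p::euclidean_space \<times> 'x::euclidean_space \<Rightarrow> 'y::euclidean_space) \<Rightarrow> 'y set \<Rightarrow> 'p \<Rightarrow> 'x \<Rightarrow> 'x \<Rightarrow> bool" where
  "strict_compl g C pb xb xs \<longleftrightarrow> (\<exists>lam\<in>rel_interior (normal_cone C (g (pb, xb))).
     adjoint (Dx g (pb, xb)) lam = xs)"

definition char_subspace ::
  "('p::euclidean_space \<times> 'x::euclidean_space \<Rightarrow> 'y::euclidean_space) \<Rightarrow> ('y \<Rightarrow> 'e::euclidean_space)
     \<Rightarrow> 'e set \<Rightarrow> 'p \<times> 'x \<Rightarrow> 'p set" where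
  "char_subspace g h K zb = {q. Dp (h \<circ> g) zb q \<in> set_plus (range (Dx (h \<circ> g) zb)) (lin_space K)}"

definition multipliers ::
  "('p::euclidean_space \<times> 'x::euclidean_space \<Rightarrow> 'y::euclidean_space) \<Rightarrow> 'y set
     \<Rightarrow> 'p \<times> 'x \<Rightarrow> 'p \<times> 'x \<Rightarrow> 'y set" where
  "multipliers g C zb zs = {lam\<in>normal_cone C (g zb). adjoint (frechet_derivative g (at zb)) lam = zs}"

definition mult_E :: "('y::euclidean_space \<Rightarrow> 'e::euclidean_space) \<Rightarrow> 'y \<Rightarrow> 'y \<Rightarrow> 'e" where
  "mult_E h y0 lam = (THE \<mu>. adjoint (frechet_derivative h (at y0)) \<mu> = lam)"

text \<open>H_lam v = \<nabla>_x g(zb)^* \<nabla>^2<\<mu>,h>(g zb) \<nabla>g(zb) v, the Hessian being the derivative of the gradient.\<close>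
definition H_op ::
  "('p::euclidean_space \<times> 'x::euclidean_space \<Rightarrow> 'y::euclidean_space) \<Rightarrow> ('y \<Rightarrow> 'e::euclidean_space)
     \<Rightarrow> 'p \<times> 'x \<Rightarrow> 'y \<Rightarrow> 'p \<times> 'x \<Rightarrow> 'x" where
  "H_op g h zb lam v = adjoint (Dx g zb)
     (frechet_derivative (\<lambda>y. adjoint (frechet_derivative h (at y)) (mult_E h (g zb) lam)) (at (g zb))
        (frechet_derivative g (at zb) v))"

definition DxT_deriv ::
  "('p::euclidean_space \<times> 'x::euclidean_space \<Rightarrow> 'y::euclidean_space) \<Rightarrow> 'p \<times> 'x \<Rightarrow> 'y \<Rightarrow> 'p \<times> 'x \<Rightarrow> 'x" where
  "DxT_deriv g zb lam v = frechet_derivative (\<lambda>z. adjoint (Dx g z) lam) (at zb) v"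

definition rhs_set ::
  "('p::euclidean_space \<times> 'x::euclidean_space \<Rightarrow> 'y::euclidean_space) \<Rightarrow> 'y set \<Rightarrow> ('y \<Rightarrow> 'e::euclidean_space)
     \<Rightarrow> 'p \<times> 'x \<Rightarrow> 'x \<Rightarrow> 'p \<times> 'x \<Rightarrow> 'x set" where
  "rhs_set g C h zb xs v = \<Union> {(\<lambda>w. DxT_deriv g zb lam v + H_op g h zb lam v + w) `
        (snd ` normal_cone (critical_cone {z. g z \<in> C} zb zs) v) | zs lam.
      zs \<in> normal_cone (tangent_cone {z. g z \<in> C} zb) v \<and> snd zs = xs \<and> lam \<in> multipliers g C zb zs}"

definition second_order_cond ::
  "('p::euclidean_space \<times> 'x::euclidean_space \<Rightarrow> 'y::euclidean_space) \<Rightarrow> ('y \<Rightarrow> 'e::euclidean_space)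
     \<Rightarrow> 'e set \<Rightarrow> 'p \<times> 'x \<Rightarrow> 'p \<times> 'x \<Rightarrow> bool" where
  "second_order_cond g h K zb v \<longleftrightarrow>
     frechet_derivative h (at (g zb)) (d2 g zb v v)
       + d2 h (g zb) (frechet_derivative g (at zb) v) (frechet_derivative g (at zb) v)
     \<in> set_plus (range (frechet_derivative h (at (g zb)) \<circ> frechet_derivative g (at zb))) (lin_space K)"

end

theory Submission
  imports Defs
begin

text \<open>Write \<open>G = h \<circ> g\<close>, \<open>L = lin K\<close> and \<open>A = \<nabla>\<^sub>x G(z)\<close> at the reference point \<open>z\<close>.
  Strict complementarity provides a multiplier in the relative interior of the polar of \<open>K\<close>. For a
  direction \<open>v\<close> whose parameter part lies in the characteristic subspace it forces \<open>\<nabla>G(z) v \<in> L\<close>,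
  and then both sides of the inclusion live on the union, over the multipliers \<open>\<mu>\<close> of \<open>xs\<close>, of
  \<open>B\<^sub>\<mu> v + A\<^sup>* (L\<^sup>\<bottom>)\<close>, where \<open>B\<^sub>\<mu>\<close> is the derivative of \<open>\<nabla>\<^sub>x G(\<cdot>)\<^sup>* \<mu>\<close> at \<open>z\<close>.
  For the inclusion, Robinson stability gives bounded multipliers along a sequence realizing an
  element of the graphical derivative, and difference quotients are passed to the limit.
  For the converse, the second-order condition yields a curve \<open>z + t v + t\<^sup>2 s / 2\<close> along which \<open>G\<close>
  is within \<open>o(t\<^sup>2)\<close> of \<open>L\<close>; minimizing \<open>- \<mu>\<^sub>t \<bullet> G\<close> plus the squared distance to the curve over
  \<open>\<Gamma>(p\<^sub>t)\<close> produces points within \<open>o(t)\<close> of the curve that carry the required normals.\<close>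

section \<open>Normal cones, tangent cones and adjoints\<close>

lemma normal_coneI:
  assumes "z \<in> S" "\<And>z'. z' \<in> S \<Longrightarrow> inner v (z' - z) \<le> 0"
  shows "v \<in> normal_cone S z"
  unfolding normal_cone_def
proof (intro CollectI conjI allI impI)
  fix e :: real assume "e > 0"
  then show "\<exists>d>0. \<forall>z'\<in>S. norm (z' - z) < d \<longrightarrow> inner v (z' - z) \<le> e * norm (z' - z)"
    by (intro exI[of _ 1]) (auto intro: order_trans[OF assms(2)])
qed (fact assms)

lemma normal_cone_eps:
  assumes "v \<in> normal_cone S z" "e > 0"
  obtains d where "d > 0" "\<And>z'. z' \<in> S \<Longrightarrow> norm (z' - z) < d \<Longrightarrow> inner v (z' - z) \<le> e * norm (z' - z)"
  using assms unfolding normal_cone_def by blast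

lemma normal_cone_mem: "v \<in> normal_cone S z \<Longrightarrow> z \<in> S"
  by (simp add: normal_cone_def)

text \<open>Dividing the local estimate by the step length removes the restriction to small
  distances, so the infinitesimal bound becomes an exact inequality on the direction.\<close>

lemma normal_cone_ray:
  assumes v: "v \<in> normal_cone S z" and ray: "\<And>s. s > 0 \<Longrightarrow> z + s *\<^sub>R w \<in> S"
  shows "inner v w \<le> 0"
proof (rule field_le_epsilon)
  fix e :: real assume e: "e > 0"
  \<comment> \<open>A strict positive bound on \<open>norm w\<close> also covers
    \<open>w = 0\<close>, so that \<open>d / c\<close> is an admissible step length.\<close>
  obtain c where c: "c > 0" "norm w < c" by (metis gt_ex le_less_trans norm_ge_zero)
  obtain d where d: "d > 0" "\<And>z'. z' \<in> S \<Longrightarrow> norm (z' - z) < d \<Longrightarrow> inner v (z' - z) \<le> e / c * norm (z' - z)"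
    using normal_cone_eps[OF v, of "e / c"] e c by auto
  define s where "s = d / c"
  have s: "s > 0" using d c by (simp add: s_def)
  have "s * norm w < s * c" using s c by simp
  then have "s * norm w < d" using c by (simp add: s_def)
  then have "inner v (s *\<^sub>R w) \<le> e / c * norm (s *\<^sub>R w)"
    using d(2)[OF ray[OF s]] s by simp
  then have "s * inner v w \<le> s * (e / c * norm w)" using s by (simp add: mult_ac)
  then have "inner v w \<le> e / c * norm w" using s by (rule mult_left_le_imp_le)
  also have "\<dots> \<le> e / c * c" using c e by (intro mult_left_mono) auto
  also have "\<dots> = e" using c by simp
  finally show "inner v w \<le> 0 + e" by simp
qed

text \<open>Fermat's rule used to manufacture normals: the negative gradient of a function at a
  local minimizer over \<open>S\<close>. It later supplies normals to \<open>C\<close> and to the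
  sets \<open>\<Gamma> p\<close>.\<close>

lemma local_min_normal_cone:
  fixes f :: "'a::real_inner \<Rightarrow> real"
  assumes "z \<in> S" "d > 0" "\<And>z'. z' \<in> S \<Longrightarrow> norm (z' - z) < d \<Longrightarrow> f z \<le> f z'"
    and der: "(f has_derivative (\<lambda>w. - inner v w)) (at z)"
  shows "v \<in> normal_cone S z"
  unfolding normal_cone_def
proof (intro CollectI conjI allI impI)
  fix e :: real assume "e > 0"
  then obtain d' where d': "d' > 0"
    "\<And>y. norm (y - z) < d' \<Longrightarrow> norm (f y - f z - (- inner v (y - z))) \<le> e * norm (y - z)"
    using der unfolding has_derivative_at_alt by blast
  show "\<exists>d>0. \<forall>z'\<in>S. norm (z' - z) < d \<longrightarrow> inner v (z' - z) \<le> e * norm (z' - z)"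
  proof (intro exI[of _ "min d d'"] conjI ballI impI)
    fix y assume "y \<in> S" "norm (y - z) < min d d'"
    then show "inner v (y - z) \<le> e * norm (y - z)"
      using d'(2)[of y] assms(3)[of y] by (simp add: abs_le_iff)
  qed (use d' assms in auto)
qed (fact assms)

lemma tangent_coneI_eventually:
  assumes "\<And>k. t k > 0" "t \<longlonglongrightarrow> 0" "w \<longlonglongrightarrow> w0" "\<forall>\<^sub>F k in sequentially. z + t k *\<^sub>R w k \<in> S"
  shows "w0 \<in> tangent_cone S z"
proof -
  obtain N where N: "\<And>k. k \<ge> N \<Longrightarrow> z + t k *\<^sub>R w k \<in> S"
    using assms(4) by (auto simp: eventually_sequentially)
  have "(\<lambda>k. t (k + N)) \<longlonglongrightarrow> 0" "(\<lambda>k. w (k + N)) \<longlonglongrightarrow> w0"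
    using assms by (auto intro: LIMSEQ_ignore_initial_segment)
  then show ?thesis
    unfolding tangent_cone_def using N assms(1)
    by (auto intro!: exI[of _ "\<lambda>k. t (k + N)"] exI[of _ "\<lambda>k. w (k + N)"])
qed

lemma has_derivative_seq_quotient:
  assumes der: "(f has_derivative D) (at a)"
    and t: "\<And>k. t k > 0" "t \<longlonglongrightarrow> 0" and v: "vk \<longlonglongrightarrow> v"
  shows "(\<lambda>k. (f (a + t k *\<^sub>R vk k) - f a) /\<^sub>R t k) \<longlonglongrightarrow> D v"
proof -
  interpret D: bounded_linear D by (rule has_derivative_bounded_linear[OF der])
  \<comment> \<open>At \<open>y = a\<close> the quotient is \<open>0 / 0 = 0\<close>, so
    \<open>\<phi>\<close> is continuous at \<open>a\<close> and may be composed with a sequence that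
    hits \<open>a\<close>.\<close>
  define \<phi> where "\<phi> y = norm (f y - f a - D (y - a)) / norm (y - a)" for y
  have "\<phi> \<midarrow>a\<rightarrow> 0"
    using der unfolding \<phi>_def has_derivative_iff_norm by auto
  then have cont: "isCont \<phi> a" by (simp add: isCont_def \<phi>_def)
  have arg: "(\<lambda>k. a + t k *\<^sub>R vk k) \<longlonglongrightarrow> a"
    using tendsto_add[OF tendsto_const tendsto_scaleR[OF t(2) v], of a] by simp
  have lim0: "(\<lambda>k. \<phi> (a + t k *\<^sub>R vk k)) \<longlonglongrightarrow> 0"
    using isCont_tendsto_compose[OF cont arg] by (simp add: \<phi>_def)
  define r where "r k = (f (a + t k *\<^sub>R vk k) - f a) /\<^sub>R t k - D (vk k)" for k
  have nr: "norm (r k) = \<phi> (a + t k *\<^sub>R vk k) * norm (vk k)" for k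
  proof (cases "vk k = 0")
    case True
    then show ?thesis by (simp add: r_def D.zero)
  next
    case False
    have tk: "t k > 0" by (rule t)
    have "r k = (f (a + t k *\<^sub>R vk k) - f a - D (t k *\<^sub>R vk k)) /\<^sub>R t k"
      using tk by (simp add: r_def D.scaleR scaleR_diff_right)
    then have "norm (r k) = norm (f (a + t k *\<^sub>R vk k) - f a - D (t k *\<^sub>R vk k)) / t k"
      using tk by (simp add: divide_inverse mult.commute)
    then show ?thesis using tk False by (simp add: \<phi>_def)
  qed
  have "(\<lambda>k. norm (r k)) \<longlonglongrightarrow> 0"
    unfolding nr using tendsto_mult[OF lim0 tendsto_norm[OF v]] by simp
  then have "r \<longlonglongrightarrow> 0" by (simp add: tendsto_norm_zero_iff)
  from tendsto_add[OF this D.tendsto[OF v]] show ?thesis by (simp add: r_def)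
qed

section \<open>Adjoints as a bounded bilinear operation\<close>

definition badj :: "('a::euclidean_space \<Rightarrow>\<^sub>L 'b::euclidean_space) \<Rightarrow> 'b \<Rightarrow> 'a" where
  "badj T = adjoint (blinfun_apply T)"

lemma inner_badj: "inner (badj T \<mu>) u = inner \<mu> (blinfun_apply T u)"
  unfolding badj_def
  by (metis adjoint_works blinfun.bounded_linear_right bounded_linear.linear inner_commute)

lemma badj_eqI: "(\<And>u. inner a u = inner \<mu> (blinfun_apply T u)) \<Longrightarrow> badj T \<mu> = a"
  by (metis inner_badj vector_eq_rdot)

lemma badj_compose: "badj (S o\<^sub>L T) \<mu> = badj T (badj S \<mu>)"
  by (rule badj_eqI) (simp add: inner_badj)

text \<open>The norm bound comes from testing \<open>T\<close> at \<open>badj T \<mu>\<close>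
  itself. Bilinearity allows limits and derivatives to be taken jointly in the operator and the
  multiplier.\<close>

lemma bounded_bilinear_badj:
  "bounded_bilinear (badj :: ('a::euclidean_space \<Rightarrow>\<^sub>L 'b::euclidean_space) \<Rightarrow> 'b \<Rightarrow> 'a)"
proof
  show "\<exists>K. \<forall>a b. norm (badj (a :: 'a \<Rightarrow>\<^sub>L 'b) b) \<le> norm a * norm b * K"
  proof (intro exI[of _ 1] allI)
    fix T :: "'a \<Rightarrow>\<^sub>L 'b" and \<mu>
    have "norm (badj T \<mu>) * norm (badj T \<mu>) = inner \<mu> (blinfun_apply T (badj T \<mu>))"
      by (metis inner_badj power2_eq_square power2_norm_eq_inner)
    also have "\<dots> \<le> norm \<mu> * norm (blinfun_apply T (badj T \<mu>))" by (rule norm_cauchy_schwarz)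
    also have "\<dots> \<le> norm \<mu> * (norm T * norm (badj T \<mu>))"
      by (intro mult_left_mono norm_blinfun) auto
    finally show "norm (badj T \<mu>) \<le> norm T * norm \<mu> * 1"
      by (cases "badj T \<mu> = 0") (auto simp: mult_ac)
  qed
qed (auto intro!: badj_eqI simp: inner_badj inner_simps blinfun.bilinear_simps)

interpretation badj: bounded_bilinear badj
  by (rule bounded_bilinear_badj)

text \<open>Composition with this injection on the right turns a full derivative into the partial
  derivative in the second variable.\<close>

definition inr_blinfun :: "'x::euclidean_space \<Rightarrow>\<^sub>L ('p::euclidean_space \<times> 'x)" where
  "inr_blinfun = Blinfun (Pair 0)"

lemma inr_blinfun_apply [simp]: "blinfun_apply inr_blinfun u = (0, u)"
  unfolding inr_blinfun_def
  by (subst bounded_linear_Blinfun_apply) (auto intro!: bounded_linear_Pair bounded_linear_zero bounded_linear_ident)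

lemma snd_badj: "snd (badj T \<mu>) = badj (T o\<^sub>L inr_blinfun) \<mu>"
proof (rule sym, rule badj_eqI)
  fix u
  show "inner (snd (badj T \<mu>)) u = inner \<mu> (blinfun_apply (T o\<^sub>L inr_blinfun) u)"
    using inner_badj[of T \<mu> "(0, u)"] by (simp add: inner_Pair_0)
qed

section \<open>Polar cones and lineality spaces\<close>

definition polar :: "'a::real_inner set \<Rightarrow> 'a set" where
  "polar K = {\<mu>. \<forall>k\<in>K. inner \<mu> k \<le> 0}"

lemma bipolar:
  fixes K :: "'a::euclidean_space set"
  assumes "closed K" "convex K" "cone K" "0 \<in> K" and w: "\<And>\<mu>. \<mu> \<in> polar K \<Longrightarrow> inner \<mu> w \<le> 0"
  shows "w \<in> K"
proof (rule ccontr)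
  assume "w \<notin> K"
  then obtain a b where ab: "inner a w < b" "\<And>x. x \<in> K \<Longrightarrow> inner a x > b"
    using separating_hyperplane_closed_point[OF assms(2,1)] by blast
  have b: "b < 0" using ab(2)[OF assms(4)] by simp
  have "inner a k \<ge> 0" if "k \<in> K" for k
  proof (rule ccontr)
    assume neg: "\<not> inner a k \<ge> 0"
    \<comment> \<open>The multiple of \<open>k\<close> at which \<open>inner a\<close> equals
      exactly \<open>b\<close>; the factor is positive because \<open>b\<close> and
      \<open>inner a k\<close> are both negative.\<close>
    have "(b / inner a k) *\<^sub>R k \<in> K"
      using assms(3) that neg b by (auto simp: cone_def divide_nonpos_neg)
    from ab(2)[OF this] neg show False by simp
  qed
  then have "- a \<in> polar K" by (auto simp: polar_def)
  from w[OF this] ab b show False by simp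
qed

lemma polar_lin_space: "\<mu> \<in> polar K \<Longrightarrow> l \<in> lin_space K \<Longrightarrow> inner \<mu> l = 0"
  unfolding polar_def lin_space_def
  by clarsimp (metis antisym inner_minus_right neg_le_0_iff_le)

lemma lin_spaceI:
  fixes K :: "'a::euclidean_space set"
  assumes "closed K" "convex K" "cone K" "0 \<in> K" "\<And>\<mu>. \<mu> \<in> polar K \<Longrightarrow> inner \<mu> w = 0"
  shows "w \<in> lin_space K"
proof -
  have "w \<in> K" "- w \<in> K" using assms by (auto intro!: bipolar[of K])
  then show ?thesis by (force simp: lin_space_def)
qed

lemma convex_cone_add: "convex K \<Longrightarrow> cone K \<Longrightarrow> a \<in> K \<Longrightarrow> b \<in> K \<Longrightarrow> a + b \<in> K"
  using convex_cone by blast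

lemma subspace_lin_space:
  assumes "convex K" "cone K" "0 \<in> K"
  shows "subspace (lin_space K)"
proof -
  have memb: "x \<in> lin_space K \<longleftrightarrow> x \<in> K \<and> - x \<in> K" for x
    unfolding lin_space_def by force
  have "c *\<^sub>R x \<in> lin_space K" if "x \<in> lin_space K" for c x
  proof (cases "c \<ge> 0")
    case True then show ?thesis using that assms(2) unfolding memb cone_def
      by (metis scaleR_minus_right)
  next
    case False
    then have "(- c) *\<^sub>R (- x) \<in> K" "(- c) *\<^sub>R x \<in> K"
      using that assms(2) unfolding memb cone_def by (simp_all del: scaleR_minus_left scaleR_minus_right)
    then show ?thesis by (simp add: memb)
  qed
  moreover have "x + y \<in> lin_space K" if "x \<in> lin_space K" "y \<in> lin_space K" for x y
    using that convex_cone_add[OF assms(1,2), of x y] convex_cone_add[OF assms(1,2), of "- x" "- y"]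
    by (simp add: memb)
  ultimately show ?thesis using assms(3) by (auto simp: subspace_def memb)
qed

text \<open>The directions orthogonal to the lineality space of \<open>K\<close> span the polar of \<open>K\<close>.\<close>

lemma rel_interior_polar_move:
  fixes K :: "'a::euclidean_space set"
  assumes K: "closed K" "convex K" "cone K" "0 \<in> K"
    and m: "m \<in> rel_interior (polar K)" and \<eta>: "\<And>l. l \<in> lin_space K \<Longrightarrow> inner \<eta> l = 0"
  obtains \<epsilon> where "\<epsilon> > 0" "m + \<epsilon> *\<^sub>R \<eta> \<in> polar K"
proof -
  \<comment> \<open>The component \<open>z\<close> of \<open>\<eta>\<close> orthogonal to the polar
    lies in the lineality space, where \<open>\<eta>\<close> vanishes, so
    \<open>z = 0\<close>.\<close>
  have "\<eta> \<in> span (polar K)"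
  proof -
    obtain y z where yz: "y \<in> span (polar K)" "\<And>w. w \<in> span (polar K) \<Longrightarrow> orthogonal z w" "\<eta> = y + z"
      using orthogonal_subspace_decomp_exists[of "polar K" \<eta>] by metis
    have "z \<in> lin_space K"
      using lin_spaceI[OF K, of z] yz(2) span_superset by (auto simp: orthogonal_def inner_commute)
    then have "inner \<eta> z = 0" using \<eta> by simp
    moreover have "inner y z = 0" using yz by (auto simp: orthogonal_def inner_commute)
    ultimately have "z = 0" using yz(3) by (simp add: inner_left_distrib)
    then show ?thesis using yz by simp
  qed
  moreover have "0 \<in> polar K" by (simp add: polar_def)
  ultimately have aff: "affine hull (polar K) = span (polar K)"
    by (simp add: affine_hull_span_0 hull_inc)
  obtain e where e: "e > 0" "m \<in> polar K" "ball m e \<inter> affine hull (polar K) \<subseteq> polar K"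
    using m unfolding mem_rel_interior_ball by blast
  obtain c where c: "c > 0" "norm \<eta> < c" by (metis gt_ex le_less_trans norm_ge_zero)
  define \<epsilon> where "\<epsilon> = e / c"
  have "\<epsilon> > 0" using e c by (simp add: \<epsilon>_def)
  have "\<epsilon> * norm \<eta> < \<epsilon> * c" using \<open>\<epsilon> > 0\<close> c by simp
  then have "\<epsilon> * norm \<eta> < e" using c by (simp add: \<epsilon>_def)
  then have "m + \<epsilon> *\<^sub>R \<eta> \<in> ball m e" using \<open>\<epsilon> > 0\<close> by (simp add: dist_norm)
  moreover have "m + \<epsilon> *\<^sub>R \<eta> \<in> span (polar K)"
    using e(2) \<open>\<eta> \<in> span (polar K)\<close> by (intro span_add span_scale) (auto intro: span_base)
  ultimately have "m + \<epsilon> *\<^sub>R \<eta> \<in> polar K" using e aff by auto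
  with \<open>\<epsilon> > 0\<close> that show ?thesis by blast
qed

text \<open>From a relative interior point one can move slightly in the direction
  \<open>- \<mu>\<close> and stay in the polar. Since \<open>m\<close> vanishes at \<open>k\<close>,
  this forces \<open>inner \<mu> k \<ge> 0\<close>, hence equality, for every \<open>\<mu>\<close>
  in the polar.\<close>

lemma rel_interior_polar_exposes_lin_space:
  fixes K :: "'a::euclidean_space set"
  assumes K: "closed K" "convex K" "cone K" "0 \<in> K"
    and m: "m \<in> rel_interior (polar K)" and k: "k \<in> K" "inner m k = 0"
  shows "k \<in> lin_space K"
proof (rule lin_spaceI[OF K])
  fix \<mu> assume \<mu>: "\<mu> \<in> polar K"
  then obtain \<epsilon> where \<epsilon>: "\<epsilon> > 0" "m + \<epsilon> *\<^sub>R (- \<mu>) \<in> polar K"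
    using rel_interior_polar_move[OF K m, of "- \<mu>"] polar_lin_space[OF \<mu>] by (metis inner_minus_left minus_zero)
  then have "inner (m + \<epsilon> *\<^sub>R (- \<mu>)) k \<le> 0" using k(1) unfolding polar_def by blast
  then have "inner \<mu> k \<ge> 0" using k(2) \<epsilon>(1) by (simp add: inner_simps zero_le_mult_iff)
  moreover have "inner \<mu> k \<le> 0" using \<mu> k by (auto simp: polar_def)
  ultimately show "inner \<mu> k = 0" by simp
qed

text \<open>Write \<open>M\<close> for the annihilator of \<open>L\<close>. The component
  \<open>z\<close> of \<open>r\<close> orthogonal to the image of \<open>M\<close> under
  \<open>badj A\<close> satisfies \<open>A z \<in> L\<close>, because the double annihilator of
  \<open>L\<close> is \<open>L\<close>; so \<open>r\<close> vanishes on \<open>z\<close> and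
  \<open>z = 0\<close>.\<close>

lemma badj_image_orthogonal:
  assumes L: "subspace L" and r: "\<And>u. blinfun_apply A u \<in> L \<Longrightarrow> inner r u = 0"
  shows "\<exists>\<eta>. (\<forall>l\<in>L. inner \<eta> l = 0) \<and> r = badj A \<eta>"
proof -
  define M where "M = {\<eta>. \<forall>l\<in>L. inner \<eta> l = 0}"
  have M: "subspace M" by (auto simp: M_def subspace_def inner_simps)
  have "subspace (badj A ` M)"
    by (rule linear_subspace_image[OF bounded_linear.linear[OF badj.bounded_linear_right] M])
  then obtain y z where yz: "y \<in> badj A ` M" "\<And>w. w \<in> badj A ` M \<Longrightarrow> orthogonal z w" "r = y + z"
    using orthogonal_subspace_decomp_exists[of "badj A ` M" r] by (metis span_eq_iff)
  have perp: "inner \<eta> (blinfun_apply A z) = 0" if "\<eta> \<in> M" for \<eta>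
    using yz(2)[of "badj A \<eta>"] that by (metis imageI inner_badj inner_commute orthogonal_def)
  have "blinfun_apply A z \<in> L"
  proof -
    obtain a b where ab: "a \<in> L" "\<And>w. w \<in> L \<Longrightarrow> orthogonal b w" "blinfun_apply A z = a + b"
      using orthogonal_subspace_decomp_exists[of L "blinfun_apply A z"] by (metis L span_eq_iff)
    have "b \<in> M" using ab(2) by (auto simp: M_def orthogonal_def)
    then have "inner b (a + b) = 0" using perp ab(3) by metis
    moreover have "inner b a = 0" using ab by (auto simp: orthogonal_def)
    ultimately have "b = 0" by (simp add: inner_right_distrib)
    then show ?thesis using ab by simp
  qed
  then have "inner r z = 0" by (rule r)
  moreover have "inner y z = 0" using yz by (metis inner_commute orthogonal_def)
  ultimately have "z = 0" using yz(3) by (simp add: inner_left_distrib)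
  then show ?thesis using yz by (auto simp: M_def)
qed

section \<open>Error bounds and multipliers\<close>

text \<open>Exact penalization: the error bound turns the normality of \<open>xs\<close> into the estimate
  \<open>xs \<bullet> u \<le> norm xs * \<kappa> * dist (A u) (cl (K - \<real>\<^sub>+ F x))\<close>, and separation from the
  compact convex set of all \<open>badj A \<mu>\<close> with bounded \<open>\<mu>\<close> yields the multiplier.\<close>

lemma bounded_multiplier_exists:
  fixes F :: "'a::euclidean_space \<Rightarrow> 'e::euclidean_space"
  assumes K: "closed K" "convex K" "cone K" and Fx: "F x \<in> K"
    and der: "(F has_derivative blinfun_apply A) (at x)"
    and xs: "xs \<in> normal_cone S x" and \<kappa>: "\<kappa> \<ge> 0"
    and U: "open U" "x \<in> U"
    and reg: "\<And>x' k e. x' \<in> U \<Longrightarrow> k \<in> K \<Longrightarrow> e > 0 \<Longrightarrow> \<exists>s\<in>S. dist x' s \<le> \<kappa> * dist (F x') k + e"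
  shows "\<exists>\<mu>\<in>polar K. inner \<mu> (F x) = 0 \<and> norm \<mu> \<le> \<kappa> * norm xs \<and> badj A \<mu> = xs"
proof -
  let ?y = "F x"
  have K0: "0 \<in> K" using Fx K(3) unfolding cone_def by (metis order_refl scaleR_zero_left)
  have est: "inner xs u \<le> norm xs * (\<kappa> * norm (blinfun_apply A u - (k - s *\<^sub>R ?y)))"
    if k: "k \<in> K" and s: "s \<ge> 0" for u k s
  proof (rule field_le_epsilon)
    fix e0 :: real assume e0: "e0 > 0"
    define D where "D = norm (blinfun_apply A u - (k - s *\<^sub>R ?y))"
    \<comment> \<open>\<open>M\<close> dominates the coefficient with which \<open>e\<close> enters
      the final estimate, so that \<open>e = min 1 (e0 / M)\<close> is absorbed by
      \<open>e0\<close>.\<close>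
    define M where "M = norm u + (\<kappa> * (D + 1) + 1) + norm xs * (\<kappa> + 1) + 1"
    have nn: "0 \<le> \<kappa> * (D + 1)" "0 \<le> norm xs * (\<kappa> + 1)" using \<kappa> by (simp_all add: D_def)
    have Mpos: "M > 0" using nn norm_ge_zero[of u] unfolding M_def by linarith
    define e where "e = min 1 (e0 / M)"
    have e: "e > 0" "e \<le> 1" "e * M \<le> e0" using e0 Mpos by (auto simp: e_def min_def field_simps)
    obtain d1 where d1: "d1 > 0" "\<And>x'. x' \<in> S \<Longrightarrow> norm (x' - x) < d1 \<Longrightarrow> inner xs (x' - x) \<le> e * norm (x' - x)"
      using normal_cone_eps[OF xs e(1)] by blast
    obtain d2 where d2: "d2 > 0" "ball x d2 \<subseteq> U" using U open_contains_ball by blast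
    have "\<exists>d3>0. \<forall>y. norm (y - x) < d3 \<longrightarrow> norm (F y - F x - blinfun_apply A (y - x)) \<le> (e / (norm u + 1)) * norm (y - x)"
    proof -
      have "e / (norm u + 1) > 0" using e by (simp add: add_nonneg_pos)
      then show ?thesis using der unfolding has_derivative_at_alt by blast
    qed
    then obtain d3 where d3: "d3 > 0" "\<And>y. norm (y - x) < d3 \<Longrightarrow>
        norm (F y - F x - blinfun_apply A (y - x)) \<le> (e / (norm u + 1)) * norm (y - x)" by blast
    define B where "B = norm u + (\<kappa> * (D + 1) + 1)"
    have Bpos: "B > 0" and uB: "norm u \<le> B"
      using nn norm_ge_zero[of u] unfolding B_def by linarith+
    \<comment> \<open>This step length keeps the test point in \<open>U\<close>, its correction
      within the radius \<open>d1\<close> and the expansion of \<open>F\<close> valid. The bound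
      \<open>t * s \<le> 1\<close> makes the coefficient of \<open>F x\<close> in \<open>?k\<close>
      nonnegative.\<close>
    define t where "t = min (min (d1/2) (min (d2/2) (d3/2)) / B) (1 / (s + 1))"
    have t: "t > 0" using d1(1) d2(1) d3(1) Bpos s by (simp add: t_def add_nonneg_pos)
    have tB: "t * B \<le> min (d1/2) (min (d2/2) (d3/2))"
    proof -
      have "t \<le> min (d1/2) (min (d2/2) (d3/2)) / B" by (simp add: t_def)
      then show ?thesis using Bpos by (simp add: pos_le_divide_eq)
    qed
    have ts: "t * s \<le> 1"
    proof -
      have "t \<le> 1 / (s + 1)" by (simp add: t_def)
      then have "t * (s + 1) \<le> 1" using s by (simp add: pos_le_divide_eq)
      then show ?thesis using t by (simp add: algebra_simps)
    qed
    let ?x' = "x + t *\<^sub>R u"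
    have ntu: "norm (?x' - x) = t * norm u" using t by simp
    have tu: "t * norm u \<le> t * B" using t uB by simp
    have small: "t * norm u < d2" "t * norm u < d3"
      using tu tB d2(1) d3(1) by linarith+
    have inU: "?x' \<in> U" using small t by (intro subsetD[OF d2(2)]) (simp add: dist_norm)
    \<comment> \<open>A conic combination of \<open>k\<close> and \<open>F x\<close> whose distance
      from \<open>F ?x'\<close> is, to first order, \<open>t * D\<close>. The error bound therefore
      moves \<open>?x'\<close> into \<open>S\<close> at cost about
      \<open>t * \<kappa> * D\<close>.\<close>
    let ?k = "t *\<^sub>R k + (1 - t * s) *\<^sub>R ?y"
    have kK: "?k \<in> K"
      using K k Fx t ts by (intro convex_cone_add) (auto simp: cone_def)
    have rem: "norm (F ?x' - F x - blinfun_apply A (t *\<^sub>R u)) \<le> t * e"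
    proof -
      have "norm (F ?x' - F x - blinfun_apply A (t *\<^sub>R u)) \<le> (e / (norm u + 1)) * (t * norm u)"
        using d3(2)[of ?x'] small(2) t by simp
      also have "\<dots> = t * e * (norm u / (norm u + 1))" by simp
      also have "\<dots> \<le> t * e * 1" using t e by (intro mult_left_mono) (auto simp: divide_le_eq add_nonneg_pos)
      finally show ?thesis by simp
    qed
    have eq: "F ?x' - ?k = (F ?x' - F x - blinfun_apply A (t *\<^sub>R u)) + t *\<^sub>R (blinfun_apply A u - (k - s *\<^sub>R ?y))"
      by (simp add: algebra_simps blinfun.scaleR_right)
    have "norm (t *\<^sub>R (blinfun_apply A u - (k - s *\<^sub>R ?y))) = t * D" using t by (simp add: D_def)
    then have dk: "dist (F ?x') ?k \<le> t * e + t * D"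
      unfolding dist_norm eq
      using norm_triangle_ineq[of "F ?x' - F x - blinfun_apply A (t *\<^sub>R u)" "t *\<^sub>R (blinfun_apply A u - (k - s *\<^sub>R ?y))"] rem
      by linarith
    obtain x'' where x'': "x'' \<in> S" "dist ?x' x'' \<le> \<kappa> * dist (F ?x') ?k + t * e"
      using reg[OF inU kK, of "t * e"] t e by auto
    have dx: "norm (x'' - ?x') \<le> t * (\<kappa> * (D + e) + e)"
    proof -
      have "\<kappa> * dist (F ?x') ?k \<le> \<kappa> * (t * e + t * D)" using dk \<kappa> by (rule mult_left_mono)
      then show ?thesis using x''(2) by (simp add: dist_norm norm_minus_commute algebra_simps)
    qed
    have "\<kappa> * (D + e) + e \<le> \<kappa> * (D + 1) + 1" using e \<kappa> by (intro add_mono mult_left_mono) auto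
    then have "t * (\<kappa> * (D + e) + e) \<le> t * (\<kappa> * (D + 1) + 1)" using t by simp
    then have nx: "norm (x'' - x) \<le> t * B"
      using norm_triangle_ineq[of "x'' - ?x'" "?x' - x"] t dx ntu
      unfolding B_def distrib_left[of t "norm u"] diff_add_cancel[of x'' ?x'] by (simp add: algebra_simps)
    then have "norm (x'' - x) < d1" using tB d1(1) by linarith
    then have "inner xs (x'' - x) \<le> e * norm (x'' - x)" using d1(2) x'' by simp
    also have "\<dots> \<le> e * (t * B)" using nx e by simp
    finally have i1: "inner xs (x'' - x) \<le> t * (e * B)" by (simp add: mult_ac)
    have i2: "inner xs (?x' - x'') \<le> norm xs * (t * (\<kappa> * (D + e) + e))"
      using norm_cauchy_schwarz[of xs "?x' - x''"] dx
      by (smt (verit) mult_left_mono norm_ge_zero norm_minus_commute)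
    have "t * inner xs u = inner xs (x'' - x) + inner xs (?x' - x'')"
      by (simp add: inner_simps)
    also have "\<dots> \<le> t * (e * B) + norm xs * (t * (\<kappa> * (D + e) + e))" using i1 i2 by simp
    also have "\<dots> = t * (norm xs * (\<kappa> * D) + e * (B + norm xs * (\<kappa> + 1)))" by (simp add: algebra_simps)
    finally have "inner xs u \<le> norm xs * (\<kappa> * D) + e * (B + norm xs * (\<kappa> + 1))" using t by simp
    moreover have "e * (B + norm xs * (\<kappa> + 1)) \<le> e * M" using e by (simp add: M_def B_def)
    ultimately show "inner xs u \<le> norm xs * (\<kappa> * norm (blinfun_apply A u - (k - s *\<^sub>R ?y))) + e0"
      using e(3) by (simp add: D_def)
  qed
  define c where "c = \<kappa> * norm xs"
  have c: "c \<ge> 0" using \<kappa> by (simp add: c_def)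
  define N where "N = {\<mu> \<in> polar K. inner \<mu> ?y = 0 \<and> norm \<mu> \<le> c}"
  \<comment> \<open>Projection requires a closed set; the estimate passes to the closure by
    continuity.\<close>
  define T where "T = closure {k - s *\<^sub>R ?y | k s. k \<in> K \<and> s \<ge> 0}"
  have T0: "convex {k - s *\<^sub>R ?y | k s. k \<in> K \<and> s \<ge> 0}"
  proof (rule convexI)
    fix a b u v :: real and X Y
    assume X: "X \<in> {k - s *\<^sub>R ?y | k s. k \<in> K \<and> s \<ge> 0}" and Y: "Y \<in> {k - s *\<^sub>R ?y | k s. k \<in> K \<and> s \<ge> 0}"
      and uv: "0 \<le> u" "0 \<le> v" "u + v = 1"
    then obtain k s k' s' where *: "X = k - s *\<^sub>R ?y" "k \<in> K" "s \<ge> 0" "Y = k' - s' *\<^sub>R ?y" "k' \<in> K" "s' \<ge> 0" by auto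
    have "u *\<^sub>R X + v *\<^sub>R Y = (u *\<^sub>R k + v *\<^sub>R k') - (u * s + v * s') *\<^sub>R ?y"
      by (simp add: * algebra_simps)
    moreover have "u *\<^sub>R k + v *\<^sub>R k' \<in> K" using K * uv by (simp add: convexD)
    moreover have "u * s + v * s' \<ge> 0" using * uv by simp
    ultimately show "u *\<^sub>R X + v *\<^sub>R Y \<in> {k - s *\<^sub>R ?y | k s. k \<in> K \<and> s \<ge> 0}"
      by blast
  qed
  have T: "closed T" "convex T" by (auto simp: T_def T0)
  have Tcone: "cone T"
  proof -
    have "cone {k - s *\<^sub>R ?y | k s. k \<in> K \<and> s \<ge> 0}"
      unfolding cone_def
    proof safe
      fix k and s r :: real assume "k \<in> K" "s \<ge> 0" "r \<ge> 0"
      then show "\<exists>k' s'. r *\<^sub>R (k - s *\<^sub>R ?y) = k' - s' *\<^sub>R ?y \<and> k' \<in> K \<and> s' \<ge> 0"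
        using K(3) by (intro exI[of _ "r *\<^sub>R k"] exI[of _ "r * s"]) (auto simp: cone_def scaleR_diff_right)
    qed
    then show ?thesis unfolding T_def by (rule cone_closure)
  qed
  have Tin: "k - s *\<^sub>R ?y \<in> T" if "k \<in> K" "s \<ge> 0" for k s
    using that closure_subset by (force simp: T_def)
  have estT: "inner xs u \<le> c * norm (blinfun_apply A u - \<tau>)" if "\<tau> \<in> T" for u \<tau>
  proof -
    have "T \<subseteq> {\<tau>. inner xs u \<le> c * norm (blinfun_apply A u - \<tau>)}"
      unfolding T_def
    proof (rule closure_minimal)
      show "{k - s *\<^sub>R ?y | k s. k \<in> K \<and> s \<ge> 0} \<subseteq> {\<tau>. inner xs u \<le> c * norm (blinfun_apply A u - \<tau>)}"
        using est by (auto simp: c_def mult_ac)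
      show "closed {\<tau>. inner xs u \<le> c * norm (blinfun_apply A u - \<tau>)}"
        by (intro closed_Collect_le continuous_intros)
    qed
    then show ?thesis using that by blast
  qed
  have "xs \<in> badj A ` N"
  proof (rule ccontr)
    assume nin: "xs \<notin> badj A ` N"
    have "convex N"
      unfolding N_def polar_def
      by (rule convexI) (auto simp: inner_simps intro!: add_nonpos_nonpos mult_nonneg_nonpos
          convex_bound_le norm_triangle_le)
    have "N = cball 0 c \<inter> ({\<mu>. inner \<mu> ?y = 0} \<inter> (\<Inter>k\<in>K. {\<mu>. inner \<mu> k \<le> 0}))"
      by (auto simp: N_def polar_def)
    moreover have "closed ({\<mu>. inner \<mu> ?y = 0} \<inter> (\<Inter>k\<in>K. {\<mu>. inner \<mu> k \<le> 0}))"
      by (intro closed_Int closed_INT ballI closed_Collect_eq closed_Collect_le continuous_intros)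
    ultimately have "compact N" by (simp add: compact_Int_closed)
    then have "compact (badj A ` N)"
      by (intro compact_continuous_image linear_continuous_on badj.bounded_linear_right)
    moreover have "convex (badj A ` N)"
      by (intro convex_linear_image bounded_linear.linear badj.bounded_linear_right \<open>convex N\<close>)
    ultimately obtain a b where ab: "inner a xs < b" "\<And>x. x \<in> badj A ` N \<Longrightarrow> inner a x > b"
      using separating_hyperplane_closed_point[of "badj A ` N" xs] nin by (auto simp: compact_imp_closed)
    define u where "u = - a"
    have sep: "inner \<mu> (blinfun_apply A u) < inner xs u" if "\<mu> \<in> N" for \<mu>
    proof -
      have "inner a (badj A \<mu>) > inner a xs" using ab(1) ab(2)[of "badj A \<mu>"] that by force
      then show ?thesis by (simp add: u_def blinfun.minus_right inner_badj[symmetric] inner_commute)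
    qed
    \<comment> \<open>The residual of the projection onto the closed convex cone \<open>T\<close> is
      orthogonal to \<open>\<tau>\<close> and polar to \<open>T\<close>. Since \<open>T\<close>
      contains \<open>K\<close> and \<open>- F x\<close>, the residual lies in
      \<open>polar K\<close> and is orthogonal to \<open>F x\<close>.\<close>
    define \<tau> where "\<tau> = closest_point T (blinfun_apply A u)"
    have Tne: "T \<noteq> {}" using Tin[OF Fx, of 0] by auto
    have \<tau>: "\<tau> \<in> T" unfolding \<tau>_def using T Tne by (intro closest_point_in_set)
    define n where "n = blinfun_apply A u - \<tau>"
    have obt: "inner n (x - \<tau>) \<le> 0" if "x \<in> T" for x
      unfolding n_def \<tau>_def using closest_point_dot[OF T(2,1) that] .
    have ray: "r *\<^sub>R \<tau> \<in> T" if "r \<ge> 0" for r using Tcone \<tau> that by (auto simp: cone_def)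
    have n\<tau>: "inner n \<tau> = 0"
      using obt[OF ray[of 0]] obt[OF ray[of 2]] by (simp add: inner_simps)
    then have nT: "inner n x \<le> 0" if "x \<in> T" for x using obt[OF that] by (simp add: inner_simps)
    have npol: "n \<in> polar K" using nT Tin[of _ 0] by (auto simp: polar_def)
    have ny: "inner n ?y = 0"
      using nT[OF Tin[OF Fx, of 0]] nT[OF Tin[OF K0, of 1]] by simp
    \<comment> \<open>Rescaled to length \<open>c\<close>, the residual gives the value
      \<open>c * norm n\<close> against \<open>A u\<close>, which contradicts \<open>estT\<close> at
      \<open>\<tau>\<close>. If \<open>n = 0\<close>, division by zero makes
      \<open>\<mu> = 0\<close>, which still lies in \<open>N\<close>.\<close>
    define \<mu> where "\<mu> = (c / norm n) *\<^sub>R n"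
    have "\<mu> \<in> N" using npol ny c
      by (auto simp: N_def \<mu>_def polar_def mult_nonneg_nonpos divide_nonpos_nonneg)
    then have "inner \<mu> (blinfun_apply A u) < inner xs u" by (rule sep)
    moreover have "inner \<mu> (blinfun_apply A u) = c * norm n"
    proof -
      have "inner n (blinfun_apply A u) = norm n * norm n"
      proof -
        have "inner n (blinfun_apply A u) = inner n (n + \<tau>)" by (simp add: n_def)
        then show ?thesis using n\<tau> by (simp add: inner_add_right norm_eq_sqrt_inner)
      qed
      then show ?thesis by (simp add: \<mu>_def)
    qed
    ultimately show False using estT[OF \<tau>, of u] by (simp add: n_def)
  qed
  then show ?thesis by (auto simp: N_def c_def)
qed

text \<open>Metric regularity of a submersion with explicit constant. Corrections are sought in the
  form \<open>B e\<close> for a fixed right inverse \<open>B\<close> of \<open>h' y0\<close>, which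
  turns the equation into a contraction fixed point problem.\<close>

lemma C1_submersion_solvable:
  fixes h :: "'y::euclidean_space \<Rightarrow> 'e::euclidean_space"
  assumes U: "open U" "y0 \<in> U" and der: "\<And>y. y \<in> U \<Longrightarrow> (h has_derivative blinfun_apply (h' y)) (at y)"
    and cont: "isCont h' y0" and surj: "surj (blinfun_apply (h' y0))"
  obtains c r where "c \<ge> 0" "r > 0"
    "\<And>y k. y \<in> ball y0 r \<Longrightarrow> dist (h y) k < r \<Longrightarrow> \<exists>y'. h y' = k \<and> dist y y' \<le> c * dist (h y) k"
proof -
  obtain B where B: "linear B" "blinfun_apply (h' y0) \<circ> B = id"
    using linear_surjective_right_inverse[OF bounded_linear.linear[OF blinfun.bounded_linear_right] surj] by blast
  interpret B: bounded_linear B using B(1) by (simp add: linear_conv_bounded_linear)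
  obtain b where b: "b > 0" "\<And>e. norm (B e) \<le> norm e * b" using B.pos_bounded by blast
  obtain \<rho>1 where \<rho>1: "\<rho>1 > 0" "ball y0 \<rho>1 \<subseteq> U" using U open_contains_ball by blast
  have "1 / (2 * b) > 0" using b by simp
  then obtain \<rho>2 where \<rho>2: "\<rho>2 > 0" "\<And>y. dist y y0 < \<rho>2 \<Longrightarrow> dist (h' y) (h' y0) < 1 / (2 * b)"
    using cont unfolding continuous_at_eps_delta by blast
  \<comment> \<open>For \<open>norm e \<le> R\<close> the shift \<open>B e\<close> has length at
    most \<open>\<rho> / 2\<close>, so \<open>y + B e\<close> stays within \<open>2 * \<rho>\<close>
    of \<open>y0\<close>. The bound \<open>r \<le> R / 2\<close> makes the contraction map the ball
    of radius \<open>R\<close> into itself.\<close>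
  define \<rho> where "\<rho> = min \<rho>1 \<rho>2 / 2"
  have \<rho>: "\<rho> > 0" using \<rho>1 \<rho>2 by (simp add: \<rho>_def)
  define R where "R = \<rho> / (2 * b)"
  have R: "R > 0" using \<rho> b by (simp add: R_def)
  define r where "r = min \<rho> (R / 2)"
  have r: "r > 0" using \<rho> R by (simp add: r_def)
  have sol: "\<exists>y'. h y' = k \<and> dist y y' \<le> (2 * b) * dist (h y) k"
    if y: "y \<in> ball y0 r" and k: "dist (h y) k < r" for y k
  proof -
    \<comment> \<open>Fixed points are exactly the corrections with \<open>h (y + B e) = k\<close>.
      As \<open>h' y0\<close> after \<open>B\<close> is the identity, the derivative of
      \<open>\<phi>\<close> has norm at most 1/2 near \<open>y0\<close>.\<close>
    define \<phi> where "\<phi> e = e - (h (y + B e) - k)" for e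
    have near: "y + B e \<in> ball y0 \<rho>1 \<inter> ball y0 \<rho>2" if "e \<in> cball 0 R" for e
    proof -
      have "norm (B e) \<le> norm e * b" by (rule b)
      also have "\<dots> \<le> R * b" using that b by simp
      also have "\<dots> = \<rho> / 2" using b by (simp add: R_def)
      finally have "dist y0 (y + B e) \<le> dist y0 y + \<rho> / 2"
        using dist_triangle[of y0 "y + B e" y] by (simp add: dist_norm)
      moreover have "dist y0 y < \<rho>" using y by (simp add: r_def)
      ultimately have "dist y0 (y + B e) < 2 * \<rho>" using \<rho> by simp
      then show ?thesis by (simp add: \<rho>_def)
    qed
    have der\<phi>: "(\<phi> has_derivative (\<lambda>d. d - blinfun_apply (h' (y + B e)) (B d))) (at e within cball 0 R)"
      if "e \<in> cball 0 R" for e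
    proof -
      have "y + B e \<in> U" using near[OF that] \<rho>1 by blast
      then have "(h has_derivative blinfun_apply (h' (y + B e))) (at (y + B e))" by (rule der)
      then have "((\<lambda>e. h (y + B e)) has_derivative (\<lambda>d. blinfun_apply (h' (y + B e)) (B d))) (at e within cball 0 R)"
        by (rule has_derivative_compose[rotated]) (auto intro!: derivative_eq_intros B.has_derivative)
      then show ?thesis unfolding \<phi>_def by (auto intro!: derivative_eq_intros)
    qed
    have lip: "dist (\<phi> e1) (\<phi> e2) \<le> 1/2 * dist e1 e2" if "e1 \<in> cball 0 R" "e2 \<in> cball 0 R" for e1 e2
    proof -
      have "norm (\<phi> e1 - \<phi> e2) \<le> 1/2 * norm (e1 - e2)"
      proof (rule differentiable_bound[OF convex_cball der\<phi>])
        fix e :: 'e assume e: "e \<in> cball 0 R"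
        show "onorm (\<lambda>d. d - blinfun_apply (h' (y + B e)) (B d)) \<le> 1/2"
        proof (rule onorm_bound)
          fix d
          have id: "blinfun_apply (h' y0) (B d) = d" using B(2) by (metis comp_apply id_apply)
          have "norm (d - blinfun_apply (h' (y + B e)) (B d)) = norm (blinfun_apply (h' y0 - h' (y + B e)) (B d))"
            by (simp add: blinfun.diff_left id)
          also have "\<dots> \<le> norm (h' y0 - h' (y + B e)) * norm (B d)" by (rule norm_blinfun)
          also have "\<dots> \<le> 1 / (2 * b) * (norm d * b)"
            using near[OF e] \<rho>2(2)[of "y + B e"] b
            by (intro mult_mono b) (auto simp: dist_norm norm_minus_commute)
          also have "\<dots> = 1/2 * norm d" using b by simp
          finally show "norm (d - blinfun_apply (h' (y + B e)) (B d)) \<le> 1/2 * norm d" .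
        qed simp
      qed (use that in auto)
      then show ?thesis by (simp add: dist_norm)
    qed
    have \<phi>0: "norm (\<phi> 0) = dist (h y) k" by (simp add: \<phi>_def B.zero dist_norm norm_minus_commute)
    have ball: "\<phi> ` cball 0 R \<subseteq> cball 0 R"
    proof (rule image_subsetI)
      fix e :: 'e assume e: "e \<in> cball 0 R"
      have "dist (\<phi> e) (\<phi> 0) \<le> 1/2 * norm e" using lip[OF e, of 0] R by simp
      then have "norm (\<phi> e) \<le> 1/2 * norm e + norm (\<phi> 0)"
        using dist_triangle[of "\<phi> e" 0 "\<phi> 0"] by simp
      also have "\<dots> \<le> R" using e k by (simp add: \<phi>0 r_def)
      finally show "\<phi> e \<in> cball 0 R" by simp
    qed
    have "\<exists>!e\<in>cball 0 R. \<phi> e = e"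
    proof (rule Banach_fix[where c = "1/2"])
      show "complete (cball (0::'e) R)" by (simp add: complete_eq_closed)
    qed (use R ball lip in auto)
    then obtain e where e: "e \<in> cball 0 R" "\<phi> e = e" by blast
    have he: "h (y + B e) = k" using e(2) by (simp add: \<phi>_def)
    have "dist (\<phi> e) (\<phi> 0) \<le> 1/2 * norm e" using lip[OF e(1), of 0] R by simp
    then have "norm e \<le> 1/2 * norm e + norm (\<phi> 0)"
      using dist_triangle[of "\<phi> e" 0 "\<phi> 0"] e(2) by simp
    then have "norm e \<le> 2 * dist (h y) k" by (simp add: \<phi>0)
    then have "norm (B e) \<le> 2 * dist (h y) k * b"
      using b(2)[of e] b(1) by (meson mult_right_mono order_trans less_imp_le)
    then show ?thesis using he by (intro exI[of _ "y + B e"]) (simp add: dist_norm mult_ac)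
  qed
  show ?thesis by (rule that[of "2 * b" r]) (use b r sol in auto)
qed

section \<open>Systems with values in a convex cone\<close>

text \<open>The problem after composition with the reduction map: the reference value is
  \<open>0\<close>, so \<open>K\<close> itself is the relevant cone. The error bound is stated
  against each \<open>k\<close> with slack \<open>e\<close>, which asks for no nearest point in
  \<open>\<Gamma> p\<close>.\<close>

locale reduced_system =
  fixes G :: "'p::euclidean_space \<times> 'x::euclidean_space \<Rightarrow> 'e::euclidean_space"
    and G' :: "'p \<times> 'x \<Rightarrow> ('p \<times> 'x) \<Rightarrow>\<^sub>L 'e"
    and G2 :: "'p \<times> 'x \<Rightarrow> ('p \<times> 'x) \<Rightarrow>\<^sub>L 'e"
    and K :: "'e set" and \<Gamma> :: "'p \<Rightarrow> 'x set" and U :: "('p \<times> 'x) set"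
    and \<kappa> :: real and pb :: 'p and xb :: 'x
  assumes open_U: "open U" and zb_U: "(pb, xb) \<in> U"
    and G_der: "\<And>z. z \<in> U \<Longrightarrow> (G has_derivative blinfun_apply (G' z)) (at z)"
    and G'_der: "(G' has_derivative G2) (at (pb, xb))"
    and G_zb: "G (pb, xb) = 0"
    and K: "closed K" "convex K" "cone K" "0 \<in> K"
    and \<Gamma>_iff: "\<And>p x. (p, x) \<in> U \<Longrightarrow> x \<in> \<Gamma> p \<longleftrightarrow> G (p, x) \<in> K"
    and \<kappa>_nonneg: "\<kappa> \<ge> 0"
    and error_bound: "\<And>p x k e. (p, x) \<in> U \<Longrightarrow> k \<in> K \<Longrightarrow> e > 0 \<Longrightarrow>
      \<exists>x'\<in>\<Gamma> p. dist x x' \<le> \<kappa> * dist (G (p, x)) k + e"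
begin

abbreviation zb :: "'p \<times> 'x" where "zb \<equiv> (pb, xb)"

definition A :: "'x \<Rightarrow>\<^sub>L 'e" where "A = G' zb o\<^sub>L inr_blinfun"

definition \<Psi> :: "'p \<times> 'x \<Rightarrow> 'x set" where "\<Psi> z = normal_cone (\<Gamma> (fst z)) (snd z)"

section \<open>Tangent cone of the graph of the feasible set mapping\<close>

lemma \<Gamma>_iff': "z \<in> U \<Longrightarrow> snd z \<in> \<Gamma> (fst z) \<longleftrightarrow> G z \<in> K"
  using \<Gamma>_iff[of "fst z" "snd z"] by simp

lemma eventually_in_U:
  assumes "t \<longlonglongrightarrow> (0::real)" "vk \<longlonglongrightarrow> v"
  shows "\<forall>\<^sub>F k in sequentially. zb + t k *\<^sub>R vk k \<in> U"
proof -
  have "(\<lambda>k. zb + t k *\<^sub>R vk k) \<longlonglongrightarrow> zb + 0 *\<^sub>R v"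
    by (intro tendsto_intros assms)
  then show ?thesis using topological_tendstoD[OF _ open_U] zb_U by force
qed

lemma scaled_G_in_K:
  assumes "t > 0" "z \<in> U" "snd z \<in> \<Gamma> (fst z)"
  shows "(G z - G zb) /\<^sub>R t \<in> K"
  using assms K(3) \<Gamma>_iff'[of z] by (simp add: G_zb cone_def)

text \<open>Difference quotients of \<open>G\<close> at feasible points lie in the closed cone
  \<open>K\<close>, which gives one inclusion. Conversely, the error bound against
  \<open>t *\<^sub>R G' zb v\<close> corrects the straight path by a displacement of order
  \<open>o(t)\<close>.\<close>

lemma tangent_cone_graph: "tangent_cone {z. snd z \<in> \<Gamma> (fst z)} zb = {v. blinfun_apply (G' zb) v \<in> K}"
proof (intro set_eqI iffI CollectI)
  fix v assume "v \<in> tangent_cone {z. snd z \<in> \<Gamma> (fst z)} zb"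
  then obtain t vk where t: "\<And>k. t k > 0" "t \<longlonglongrightarrow> 0" "vk \<longlonglongrightarrow> v"
    and mem: "\<And>k. snd (zb + t k *\<^sub>R vk k) \<in> \<Gamma> (fst (zb + t k *\<^sub>R vk k))"
    unfolding tangent_cone_def by blast
  have "\<forall>\<^sub>F k in sequentially. (G (zb + t k *\<^sub>R vk k) - G zb) /\<^sub>R t k \<in> K"
    using eventually_in_U[OF t(2,3)] by eventually_elim (intro scaled_G_in_K t(1) mem)
  then show "blinfun_apply (G' zb) v \<in> K"
    by (rule Lim_in_closed_set[OF K(1) _ _ has_derivative_seq_quotient[OF G_der[OF zb_U] t]]) simp
next
  fix v assume "v \<in> {v. blinfun_apply (G' zb) v \<in> K}"
  then have vK: "blinfun_apply (G' zb) v \<in> K" by simp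
  obtain q u where v: "v = (q, u)" by (cases v)
  define t where "t k = inverse (real (Suc k))" for k
  have t: "t k > 0" for k by (simp add: t_def)
  have t0: "t \<longlonglongrightarrow> 0" unfolding t_def by (rule LIMSEQ_inverse_real_of_nat)
  define d where "d k = (G (zb + t k *\<^sub>R v) - G zb) /\<^sub>R t k - blinfun_apply (G' zb) v" for k
  have "d \<longlonglongrightarrow> blinfun_apply (G' zb) v - blinfun_apply (G' zb) v"
    unfolding d_def by (intro tendsto_diff has_derivative_seq_quotient[OF G_der[OF zb_U] t t0] tendsto_const)
  then have d0: "d \<longlonglongrightarrow> 0" by simp
  \<comment> \<open>Only the second component is corrected, so the parameter direction stays
    \<open>q\<close>. The slack in the error bound is taken as \<open>t k * t k\<close>, which is of
    smaller order than \<open>t k\<close>.\<close>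
  have "\<exists>x'. zb + t k *\<^sub>R v \<in> U \<longrightarrow> x' \<in> \<Gamma> (pb + t k *\<^sub>R q) \<and>
      norm (x' - (xb + t k *\<^sub>R u)) \<le> t k * (\<kappa> * norm (d k) + t k)" for k
  proof (cases "zb + t k *\<^sub>R v \<in> U")
    case True
    have "t k *\<^sub>R blinfun_apply (G' zb) v \<in> K" using vK K(3) t[of k] by (simp add: cone_def)
    then obtain x' where x': "x' \<in> \<Gamma> (pb + t k *\<^sub>R q)"
      "dist (xb + t k *\<^sub>R u) x' \<le> \<kappa> * dist (G (zb + t k *\<^sub>R v)) (t k *\<^sub>R blinfun_apply (G' zb) v) + t k * t k"
      using error_bound[of "pb + t k *\<^sub>R q" "xb + t k *\<^sub>R u" _ "t k * t k"] True t[of k] by (auto simp: v)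
    have "t k *\<^sub>R d k = G (zb + t k *\<^sub>R v) - t k *\<^sub>R blinfun_apply (G' zb) v"
      using t[of k] by (simp add: d_def G_zb scaleR_diff_right)
    then have "dist (G (zb + t k *\<^sub>R v)) (t k *\<^sub>R blinfun_apply (G' zb) v) = t k * norm (d k)"
      using t[of k] by (metis abs_of_pos dist_norm norm_scaleR)
    then show ?thesis using x' by (auto simp: dist_norm norm_minus_commute algebra_simps)
  qed blast
  then obtain x' where x': "\<And>k. zb + t k *\<^sub>R v \<in> U \<Longrightarrow> x' k \<in> \<Gamma> (pb + t k *\<^sub>R q)"
    "\<And>k. zb + t k *\<^sub>R v \<in> U \<Longrightarrow> norm (x' k - (xb + t k *\<^sub>R u)) \<le> t k * (\<kappa> * norm (d k) + t k)"
    by metis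
  define y where "y k = (x' k - (xb + t k *\<^sub>R u)) /\<^sub>R t k" for k
  have ev: "\<forall>\<^sub>F k in sequentially. zb + t k *\<^sub>R v \<in> U" by (rule eventually_in_U[OF t0 tendsto_const])
  have "\<forall>\<^sub>F k in sequentially. norm (y k) \<le> \<kappa> * norm (d k) + t k"
    using ev
  proof eventually_elim
    case (elim k)
    have "norm (y k) = norm (x' k - (xb + t k *\<^sub>R u)) / t k"
      using t[of k] by (simp add: y_def divide_inverse mult.commute)
    then show ?case using x'(2)[OF elim] t[of k] by (simp add: divide_le_eq mult.commute)
  qed
  moreover have "(\<lambda>k. \<kappa> * norm (d k) + t k) \<longlonglongrightarrow> 0"
    using tendsto_add[OF tendsto_mult[OF tendsto_const[of \<kappa>] tendsto_norm[OF d0]] t0] by simp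
  ultimately have y0: "y \<longlonglongrightarrow> 0" by (rule Lim_null_comparison)
  have lim: "(\<lambda>k. (q, u + y k)) \<longlonglongrightarrow> v"
    unfolding v using tendsto_Pair[OF tendsto_const tendsto_add[OF tendsto_const y0]] by simp
  have "\<forall>\<^sub>F k in sequentially. zb + t k *\<^sub>R (q, u + y k) \<in> {z. snd z \<in> \<Gamma> (fst z)}"
    using ev
  proof eventually_elim
    case (elim k)
    have "xb + t k *\<^sub>R (u + y k) = x' k" using t[of k] by (simp add: y_def scaleR_add_right)
    then show ?case using x'(1)[OF elim] by simp
  qed
  with t t0 lim show "v \<in> tangent_cone {z. snd z \<in> \<Gamma> (fst z)} zb" by (rule tangent_coneI_eventually)
qed

section \<open>Outer estimate of the graphical derivative\<close>

lemma G'_quotient: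
  assumes "\<And>k. t k > 0" "t \<longlonglongrightarrow> 0" "vk \<longlonglongrightarrow> v"
  shows "(\<lambda>k. ((G' (zb + t k *\<^sub>R vk k) - G' zb) /\<^sub>R t k) o\<^sub>L inr_blinfun) \<longlonglongrightarrow> (G2 v o\<^sub>L inr_blinfun)"
  by (intro bounded_bilinear.tendsto[OF bounded_bilinear_blinfun_compose] tendsto_const
      has_derivative_seq_quotient[OF G'_der] assms)

text \<open>Multipliers along the approximating sequence are uniformly bounded, so a subsequence
  converges to a multiplier \<open>\<mu>\<close> of \<open>xs\<close>. Subtracting the two
  multiplier equations and dividing by the step length separates the curvature term from an element
  of the image of the annihilator of the lineality space.\<close>

lemma graph_deriv_outer:
  assumes "w \<in> graph_deriv \<Psi> zb xs v"
  shows "blinfun_apply (G' zb) v \<in> K \<and>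
    (\<exists>\<mu>\<in>polar K. \<exists>\<eta>. badj A \<mu> = xs \<and> inner \<mu> (blinfun_apply (G' zb) v) = 0 \<and>
      (\<forall>l\<in>lin_space K. inner \<eta> l = 0) \<and> w = badj (G2 v o\<^sub>L inr_blinfun) \<mu> + badj A \<eta>)"
proof -
  obtain t \<omega> where t: "\<And>k. t k > 0" "t \<longlonglongrightarrow> 0" and \<omega>: "\<omega> \<longlonglongrightarrow> (v, w)"
    and mem: "\<And>k. (zb, xs) + t k *\<^sub>R \<omega> k \<in> gph \<Psi>"
    using assms unfolding graph_deriv_def tangent_cone_def by blast
  define vk wk where "vk k = fst (\<omega> k)" and "wk k = snd (\<omega> k)" for k
  have vk: "vk \<longlonglongrightarrow> v" and wk: "wk \<longlonglongrightarrow> w"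
    using tendsto_fst[OF \<omega>] tendsto_snd[OF \<omega>] by (simp_all add: vk_def[abs_def] wk_def[abs_def])
  define Z where "Z k = zb + t k *\<^sub>R vk k" for k
  have nc: "xs + t k *\<^sub>R wk k \<in> normal_cone (\<Gamma> (fst (Z k))) (snd (Z k))" for k
    using mem[of k] by (cases "\<omega> k") (simp add: gph_def \<Psi>_def Z_def vk_def wk_def)
  obtain N where N: "\<And>k. k \<ge> N \<Longrightarrow> Z k \<in> U"
    using eventually_in_U[OF t(2) vk] by (auto simp: eventually_sequentially Z_def)
  have GK: "G (Z k) \<in> K" if "k \<ge> N" for k
    using \<Gamma>_iff'[OF N[OF that]] normal_cone_mem[OF nc[of k]] by simp
  \<comment> \<open>The parameter is frozen at \<open>fst (Z k)\<close> and the multiplier result is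
    applied on the slice of \<open>U\<close>. The factor \<open>\<kappa>\<close> does not depend on
    \<open>k\<close>, hence the uniform bound.\<close>
  have "\<exists>\<mu>. \<mu> \<in> polar K \<and> inner \<mu> (G (Z k)) = 0 \<and> norm \<mu> \<le> \<kappa> * norm (xs + t k *\<^sub>R wk k) \<and>
      badj (G' (Z k) o\<^sub>L inr_blinfun) \<mu> = xs + t k *\<^sub>R wk k" if k: "k \<ge> N" for k
  proof -
    let ?F = "\<lambda>x. G (fst (Z k), x)"
    let ?V = "(\<lambda>x. (fst (Z k), x)) -` U"
    have der: "(?F has_derivative blinfun_apply (G' (Z k) o\<^sub>L inr_blinfun)) (at (snd (Z k)))"
    proof -
      have "((\<lambda>x. (fst (Z k), x)) has_derivative (\<lambda>d. (0, d))) (at (snd (Z k)))"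
        by (auto intro!: derivative_eq_intros)
      from has_derivative_compose[OF this, of G "blinfun_apply (G' (Z k))"] G_der[OF N[OF k]]
      have "(?F has_derivative (\<lambda>x. blinfun_apply (G' (Z k)) (0, x))) (at (snd (Z k)))" by simp
      moreover have "blinfun_apply (G' (Z k) o\<^sub>L inr_blinfun) = (\<lambda>x. blinfun_apply (G' (Z k)) (0, x))"
        by auto
      ultimately show ?thesis by simp
    qed
    have "\<exists>\<mu>\<in>polar K. inner \<mu> (?F (snd (Z k))) = 0 \<and> norm \<mu> \<le> \<kappa> * norm (xs + t k *\<^sub>R wk k) \<and>
        badj (G' (Z k) o\<^sub>L inr_blinfun) \<mu> = xs + t k *\<^sub>R wk k"
    proof (rule bounded_multiplier_exists[OF K(1-3) _ der nc \<kappa>_nonneg, where U = ?V])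
      show "open ?V" by (intro open_vimage open_U continuous_intros)
      show "snd (Z k) \<in> ?V" using N[OF k] by simp
    qed (use GK[OF k] error_bound in auto)
    then show ?thesis by auto
  qed
  then obtain \<mu>s where \<mu>s: "\<And>k. k \<ge> N \<Longrightarrow> \<mu>s k \<in> polar K" "\<And>k. k \<ge> N \<Longrightarrow> inner (\<mu>s k) (G (Z k)) = 0"
    "\<And>k. k \<ge> N \<Longrightarrow> norm (\<mu>s k) \<le> \<kappa> * norm (xs + t k *\<^sub>R wk k)"
    "\<And>k. k \<ge> N \<Longrightarrow> badj (G' (Z k) o\<^sub>L inr_blinfun) (\<mu>s k) = xs + t k *\<^sub>R wk k"
    by metis
  have lim_xs: "(\<lambda>k. xs + t k *\<^sub>R wk k) \<longlonglongrightarrow> xs"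
    using tendsto_add[OF tendsto_const tendsto_scaleR[OF t(2) wk], of xs] by simp
  then have "Bseq (\<lambda>k. xs + t k *\<^sub>R wk k)" by (intro convergent_imp_Bseq) (auto simp: convergent_def)
  then obtain B where B: "\<And>k. norm (xs + t k *\<^sub>R wk k) \<le> B" by (auto simp: Bseq_def)
  have "norm (\<mu>s (k + N)) \<le> \<kappa> * B" for k
    by (rule order_trans[OF \<mu>s(3) mult_left_mono[OF B \<kappa>_nonneg]]) simp
  then have "bounded (range (\<lambda>k. \<mu>s (k + N)))" by (auto simp: bounded_iff)
  then obtain \<mu> r where r: "strict_mono (r :: nat \<Rightarrow> nat)" and lim: "((\<lambda>k. \<mu>s (k + N)) \<circ> r) \<longlonglongrightarrow> \<mu>"
    using bounded_imp_convergent_subsequence by metis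
  define \<sigma> where "\<sigma> k = r k + N" for k
  have \<sigma>: "strict_mono \<sigma>" using r by (simp add: \<sigma>_def strict_mono_def)
  have \<sigma>N: "\<sigma> k \<ge> N" for k by (simp add: \<sigma>_def)
  note sub = LIMSEQ_subseq_LIMSEQ[OF _ \<sigma>, unfolded comp_def]
  define T V W M where "T k = t (\<sigma> k)" and "V k = vk (\<sigma> k)" and "W k = wk (\<sigma> k)" and "M k = \<mu>s (\<sigma> k)" for k
  have T: "\<And>k. T k > 0" "T \<longlonglongrightarrow> 0" and V: "V \<longlonglongrightarrow> v" and W: "W \<longlonglongrightarrow> w" and M: "M \<longlonglongrightarrow> \<mu>"
    using t sub[OF t(2)] sub[OF vk] sub[OF wk] lim
    by (simp_all add: T_def[abs_def] V_def[abs_def] W_def[abs_def] M_def[abs_def] \<sigma>_def comp_def)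
  have ZV: "Z (\<sigma> k) = zb + T k *\<^sub>R V k" for k by (simp add: Z_def T_def V_def)
  have Mpol: "M k \<in> polar K" for k using \<mu>s(1)[OF \<sigma>N] by (simp add: M_def)
  have MG: "inner (M k) (G (zb + T k *\<^sub>R V k)) = 0" for k using \<mu>s(2)[OF \<sigma>N, of k] ZV by (simp add: M_def)
  have MA: "badj (G' (zb + T k *\<^sub>R V k) o\<^sub>L inr_blinfun) (M k) = xs + T k *\<^sub>R W k" for k
    using \<mu>s(4)[OF \<sigma>N, of k] by (simp add: M_def ZV T_def W_def)
  have \<mu>pol: "\<mu> \<in> polar K"
    unfolding polar_def
  proof (intro CollectI ballI)
    fix k assume "k \<in> K"
    then show "inner \<mu> k \<le> 0"
      using Mpol by (intro LIMSEQ_le_const2[OF tendsto_inner[OF M tendsto_const]]) (auto simp: polar_def)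
  qed
  have Q: "(\<lambda>k. (G (zb + T k *\<^sub>R V k) - G zb) /\<^sub>R T k) \<longlonglongrightarrow> blinfun_apply (G' zb) v"
    by (rule has_derivative_seq_quotient[OF G_der[OF zb_U] T V])
  have vK: "blinfun_apply (G' zb) v \<in> K"
  proof (rule Lim_in_closed_set[OF K(1) _ _ Q])
    have "(G (zb + T k *\<^sub>R V k) - G zb) /\<^sub>R T k \<in> K" for k
      using GK[OF \<sigma>N, of k] ZV[of k] T(1)[of k] K(3) by (simp add: G_zb cone_def)
    then show "\<forall>\<^sub>F k in sequentially. (G (zb + T k *\<^sub>R V k) - G zb) /\<^sub>R T k \<in> K" by simp
  qed simp
  have "(\<lambda>k. inner (M k) ((G (zb + T k *\<^sub>R V k) - G zb) /\<^sub>R T k)) \<longlonglongrightarrow> inner \<mu> (blinfun_apply (G' zb) v)"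
    by (intro tendsto_inner M Q)
  then have \<mu>v: "inner \<mu> (blinfun_apply (G' zb) v) = 0"
    using MG by (simp add: G_zb LIMSEQ_const_iff)
  let ?D = "\<lambda>k. ((G' (zb + T k *\<^sub>R V k) - G' zb) /\<^sub>R T k) o\<^sub>L inr_blinfun"
  have D: "?D \<longlonglongrightarrow> (G2 v o\<^sub>L inr_blinfun)" by (rule G'_quotient[OF T V])
  have expand: "badj (G' (zb + T k *\<^sub>R V k) o\<^sub>L inr_blinfun) m = T k *\<^sub>R badj (?D k) m + badj A m" for k m
  proof -
    have "G' (zb + T k *\<^sub>R V k) o\<^sub>L inr_blinfun = T k *\<^sub>R ?D k + A"
      using T(1)[of k] by (intro blinfun_eqI) (simp add: A_def blinfun.bilinear_simps)
    then show ?thesis by (simp add: badj.add_left badj.scaleR_left)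
  qed
  have "(\<lambda>k. T k *\<^sub>R badj (?D k) (M k) + badj A (M k)) \<longlonglongrightarrow> 0 *\<^sub>R badj (G2 v o\<^sub>L inr_blinfun) \<mu> + badj A \<mu>"
    by (intro tendsto_intros badj.tendsto T D M)
  moreover have "(\<lambda>k. T k *\<^sub>R badj (?D k) (M k) + badj A (M k)) \<longlonglongrightarrow> xs"
    using sub[OF lim_xs] unfolding expand[symmetric] MA by (simp add: T_def W_def)
  ultimately have \<mu>xs: "badj A \<mu> = xs" using LIMSEQ_unique by fastforce
  \<comment> \<open>The quotients \<open>(M k - \<mu>) /\<^sub>R T k\<close> may diverge, but they
    lie in the subspace \<open>P\<close>. Its image under \<open>badj A\<close> is a
    finite-dimensional subspace, hence closed, and so contains the limit.\<close>
  define P where "P = {\<eta>. \<forall>l\<in>lin_space K. inner \<eta> l = 0}"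
  have "subspace P" by (auto simp: P_def subspace_def inner_simps)
  then have subP: "subspace (badj A ` P)"
    by (intro linear_subspace_image bounded_linear.linear badj.bounded_linear_right)
  have "w - badj (G2 v o\<^sub>L inr_blinfun) \<mu> \<in> badj A ` P"
  proof (rule Lim_in_closed_set[OF closed_subspace[OF subP]])
    show "(\<lambda>k. W k - badj (?D k) (M k)) \<longlonglongrightarrow> w - badj (G2 v o\<^sub>L inr_blinfun) \<mu>"
      by (intro tendsto_intros badj.tendsto W D M)
    have "W k - badj (?D k) (M k) = badj A ((M k - \<mu>) /\<^sub>R T k)" for k
    proof -
      have "T k *\<^sub>R (W k - badj (?D k) (M k)) = badj A (M k - \<mu>)"
        using MA[of k, unfolded expand] by (simp add: badj.diff_right \<mu>xs algebra_simps)
      then have "W k - badj (?D k) (M k) = badj A (M k - \<mu>) /\<^sub>R T k"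
        using T(1)[of k] by (metis less_irrefl scaleR_one scaleR_scaleR left_inverse)
      then show ?thesis by (simp add: badj.scaleR_right)
    qed
    moreover have "(M k - \<mu>) /\<^sub>R T k \<in> P" for k
      using polar_lin_space[OF Mpol] polar_lin_space[OF \<mu>pol] by (simp add: P_def inner_diff_left)
    ultimately show "\<forall>\<^sub>F k in sequentially. W k - badj (?D k) (M k) \<in> badj A ` P" by auto
  qed simp
  then obtain \<eta> where "\<eta> \<in> P" "w - badj (G2 v o\<^sub>L inr_blinfun) \<mu> = badj A \<eta>" by blast
  then show ?thesis using vK \<mu>pol \<mu>xs \<mu>v
    by (intro conjI bexI[of _ \<mu>] exI[of _ \<eta>]) (auto simp: P_def algebra_simps)
qed

section \<open>Inner estimate of the graphical derivative\<close>

lemma local_bounds: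
  obtains \<rho> M where "\<rho> > 0" "M \<ge> 0" "cball pb \<rho> \<times> cball xb \<rho> \<subseteq> U"
    "\<And>z. z \<in> cball pb \<rho> \<times> cball xb \<rho> \<Longrightarrow> norm (G' z) \<le> M"
proof -
  have "isCont G' zb" by (rule has_derivative_continuous[OF G'_der])
  then obtain d where d: "d > 0" "\<And>z. dist z zb < d \<Longrightarrow> dist (G' z) (G' zb) < 1"
    unfolding continuous_at_eps_delta by (metis zero_less_one)
  obtain r where r: "r > 0" "ball zb r \<subseteq> U" using open_U zb_U open_contains_ball by blast
  \<comment> \<open>A third of the radius keeps the sum of the two coordinate distances strictly
    below \<open>min d r\<close>.\<close>
  define \<rho> where "\<rho> = min d r / 3"
  have \<rho>: "\<rho> > 0" using d r by (simp add: \<rho>_def)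
  have near: "dist z zb < min d r" if "z \<in> cball pb \<rho> \<times> cball xb \<rho>" for z
  proof -
    have "dist z zb \<le> dist (fst z) pb + dist (snd z) xb"
      by (cases z) (simp add: dist_Pair_Pair sqrt_sum_squares_le_sum)
    also have "\<dots> \<le> \<rho> + \<rho>" using that by (intro add_mono) (auto simp: dist_commute)
    also have "\<dots> < min d r" using d(1) r(1) unfolding \<rho>_def by linarith
    finally show ?thesis .
  qed
  show ?thesis
  proof (rule that[of \<rho> "norm (G' zb) + 1"])
    show "cball pb \<rho> \<times> cball xb \<rho> \<subseteq> U"
      using near r(2) by (metis dist_commute mem_ball min_less_iff_conj subsetD subsetI)
    fix z assume "z \<in> cball pb \<rho> \<times> cball xb \<rho>"
    then have "dist (G' z) (G' zb) < 1" using near d(2) by simp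
    then show "norm (G' z) \<le> norm (G' zb) + 1"
      using norm_triangle_ineq2[of "G' z" "G' zb"] by (simp add: dist_norm)
  qed (use \<rho> in auto)
qed

text \<open>The function \<open>- m \<bullet> G (p, x) + (norm (x - x0))\<^sup>2\<close> is at least \<open>(norm (x - x0))\<^sup>2\<close> on \<open>\<Gamma> p\<close>,
  while the error bound provides a point of \<open>\<Gamma> p\<close> where it is of order \<open>d\<close>; hence its
  minimizer is close to \<open>x0\<close>, and the optimality condition there produces a normal vector.\<close>

lemma normal_near_lineality:
  assumes \<rho>: "\<rho> > 0" "M \<ge> 0" "cball pb \<rho> \<times> cball xb \<rho> \<subseteq> U"
    "\<And>z. z \<in> cball pb \<rho> \<times> cball xb \<rho> \<Longrightarrow> norm (G' z) \<le> M"
    and m: "m \<in> polar K" and p: "p \<in> cball pb \<rho>" and x0: "norm (x0 - xb) \<le> \<rho> / 2"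
    and l: "l \<in> lin_space K" and d: "d > 0" "norm (G (p, x0) - l) \<le> d" "(\<kappa> + 1) * d \<le> \<rho> / 2"
    and E: "E = norm m * ((M * (\<kappa> + 1) + 1) * d) + ((\<kappa> + 1) * d)\<^sup>2" "E < (\<rho> / 2)\<^sup>2"
  shows "\<exists>x. x \<in> \<Gamma> p \<and> (norm (x - x0))\<^sup>2 \<le> E \<and> norm (x - xb) < \<rho> \<and>
    badj (G' (p, x) o\<^sub>L inr_blinfun) m - 2 *\<^sub>R (x - x0) \<in> normal_cone (\<Gamma> p) x"
proof -
  have inU: "(p, x) \<in> U" if "x \<in> cball xb \<rho>" for x
    by (rule subsetD[OF \<rho>(3)]) (use p that in simp)
  have x0in: "x0 \<in> cball xb \<rho>" using x0 \<rho>(1) by (simp add: dist_norm norm_minus_commute)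
  define f where "f x = - inner m (G (p, x)) + (norm (x - x0))\<^sup>2" for x
  define F where "F = {x \<in> cball xb \<rho>. G (p, x) \<in> K}"
  have F\<Gamma>: "x \<in> F \<longleftrightarrow> x \<in> \<Gamma> p" if "x \<in> cball xb \<rho>" for x
    using that \<Gamma>_iff[OF inU[OF that]] by (simp add: F_def)
  have contG: "continuous_on (cball xb \<rho>) (\<lambda>x. G (p, x))"
  proof (rule continuous_on_compose2[where g = G and t = U])
    show "continuous_on U G"
      by (rule continuous_at_imp_continuous_on) (blast intro: has_derivative_continuous[OF G_der])
  qed (use inU in \<open>auto intro!: continuous_intros\<close>)
  have "closed F"
    unfolding F_def using continuous_closed_preimage[OF contG closed_cball K(1)]
    by (simp add: vimage_def Int_def)
  moreover have "bounded F" by (rule bounded_subset[OF bounded_cball]) (auto simp: F_def)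
  ultimately have "compact F" by (simp add: compact_eq_bounded_closed)
  obtain x' where x': "x' \<in> \<Gamma> p" "dist x0 x' \<le> \<kappa> * dist (G (p, x0)) l + d"
    using error_bound[OF inU[OF x0in] _ d(1)] l by (auto simp: lin_space_def)
  have "\<kappa> * dist (G (p, x0)) l \<le> \<kappa> * d" using d(2) \<kappa>_nonneg by (intro mult_left_mono) (auto simp: dist_norm)
  then have nx': "norm (x' - x0) \<le> (\<kappa> + 1) * d"
    using x'(2) by (simp add: dist_norm norm_minus_commute algebra_simps)
  have x'in: "x' \<in> cball xb \<rho>"
    using nx' d(3) x0 norm_triangle_ineq[of "x' - x0" "x0 - xb"]
    by (simp add: dist_norm norm_minus_commute)
  then have x'F: "x' \<in> F" using F\<Gamma> x' by blast
  have "continuous_on F f"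
    unfolding f_def by (intro continuous_intros continuous_on_subset[OF contG]) (auto simp: F_def)
  then obtain x where x: "x \<in> F" "\<And>y. y \<in> F \<Longrightarrow> f x \<le> f y"
    using continuous_attains_inf[OF \<open>compact F\<close>] x'F by blast
  have xin: "x \<in> cball xb \<rho>" using x(1) by (simp add: F_def)
  have "norm (G (p, x') - G (p, x0)) \<le> M * norm ((p, x') - (p, x0))"
  proof (rule differentiable_bound[where S = "cball pb \<rho> \<times> cball xb \<rho>" and f = G
      and f' = "\<lambda>z. blinfun_apply (G' z)" and x = "(p, x')" and y = "(p, x0)" and B = M])
    fix z assume z: "z \<in> cball pb \<rho> \<times> cball xb \<rho>"
    show "(G has_derivative blinfun_apply (G' z)) (at z within cball pb \<rho> \<times> cball xb \<rho>)"
      by (rule has_derivative_at_withinI[OF G_der[OF subsetD[OF \<rho>(3) z]]])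
    show "onorm (blinfun_apply (G' z)) \<le> M" using \<rho>(4)[OF z] by (simp add: norm_blinfun.rep_eq)
  qed (use p x'in x0in in \<open>auto intro: convex_Times\<close>)
  also have "\<dots> \<le> M * ((\<kappa> + 1) * d)" using nx' \<rho>(2) by (intro mult_left_mono) (auto simp: norm_Pair)
  finally have "norm (G (p, x') - l) \<le> (M * (\<kappa> + 1) + 1) * d"
    using norm_triangle_ineq[of "G (p, x') - G (p, x0)" "G (p, x0) - l"] d(2) by (simp add: algebra_simps)
  then have "norm m * norm (G (p, x') - l) \<le> norm m * ((M * (\<kappa> + 1) + 1) * d)"
    by (intro mult_left_mono) auto
  \<comment> \<open>As \<open>m\<close> vanishes on the lineality space, \<open>l\<close> can be
    subtracted for free, and only the distance of \<open>G (p, x')\<close> from \<open>l\<close>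
    counts.\<close>
  moreover have "- inner m (G (p, x')) \<le> norm m * norm (G (p, x') - l)"
    using Cauchy_Schwarz_ineq2[of m "G (p, x') - l"] polar_lin_space[OF m l]
    by (simp add: inner_diff_right)
  moreover have "(norm (x' - x0))\<^sup>2 \<le> ((\<kappa> + 1) * d)\<^sup>2" using nx' by (intro power_mono) auto
  ultimately have "f x' \<le> E" by (simp add: f_def E)
  moreover have "(norm (x - x0))\<^sup>2 \<le> f x" using m x(1) by (auto simp: f_def F_def polar_def)
  ultimately have xE: "(norm (x - x0))\<^sup>2 \<le> E" using x(2)[OF x'F] by simp
  then have "(norm (x - x0))\<^sup>2 < (\<rho> / 2)\<^sup>2" using E(2) by simp
  then have "norm (x - x0) < \<rho> / 2" by (rule power_less_imp_less_base) (use \<rho>(1) in simp)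
  \<comment> \<open>The minimizer is interior to the ball used for compactness, so it is a local
    minimizer over all of \<open>\<Gamma> p\<close>.\<close>
  then have xint: "norm (x - xb) < \<rho>"
    using x0 norm_triangle_ineq[of "x - x0" "x0 - xb"] by simp
  have "((\<lambda>x. (p, x)) has_derivative (\<lambda>d. (0, d))) (at x)"
    by (auto intro!: derivative_eq_intros)
  then have der: "((\<lambda>x. G (p, x)) has_derivative (\<lambda>d. blinfun_apply (G' (p, x)) (0, d))) (at x)"
    by (rule has_derivative_compose) (rule G_der[OF inU[OF xin]])
  have sq: "((\<lambda>x. (norm (x - x0))\<^sup>2) has_derivative (\<lambda>d. 2 * inner (x - x0) d)) (at x)"
    unfolding power2_norm_eq_inner
    by (auto intro!: derivative_eq_intros simp: inner_commute)
  have "badj (G' (p, x) o\<^sub>L inr_blinfun) m - 2 *\<^sub>R (x - x0) \<in> normal_cone (\<Gamma> p) x"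
  proof (rule local_min_normal_cone[where f = f and d = "\<rho> - norm (x - xb)"])
    show "x \<in> \<Gamma> p" using F\<Gamma>[OF xin] x(1) by blast
    show "f x \<le> f y" if "y \<in> \<Gamma> p" "norm (y - x) < \<rho> - norm (x - xb)" for y
    proof -
      have "y \<in> cball xb \<rho>"
        using that(2) norm_triangle_ineq[of "y - x" "x - xb"] by (simp add: dist_norm norm_minus_commute)
      then show ?thesis using x(2) F\<Gamma> that(1) by blast
    qed
    show "(f has_derivative (\<lambda>w. - inner (badj (G' (p, x) o\<^sub>L inr_blinfun) m - 2 *\<^sub>R (x - x0)) w)) (at x)"
      unfolding f_def
      by (rule derivative_eq_intros der sq refl)+ (simp add: inner_badj inner_diff_left fun_eq_iff)
  qed (use xint in auto)
  then show ?thesis using F\<Gamma>[OF xin] x(1) xE xint by blast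
qed

text \<open>The correction enters with a minus sign, so its image cancels the part
  \<open>G' zb s\<close> of \<open>G2 v v\<close> and leaves \<open>l\<close>. The derivative of the
  remainder is \<open>o(t)\<close>, by differentiability of \<open>G'\<close> at the reference
  point, and the mean value inequality turns this into \<open>o(t)\<close> times
  \<open>t\<close>.\<close>

lemma second_order_curve:
  assumes s: "G2 v v = blinfun_apply (G' zb) s + l" and e: "e > 0"
  shows "\<exists>\<delta>>0. \<forall>t. 0 < t \<and> t < \<delta> \<longrightarrow>
    norm (G (zb + t *\<^sub>R v - (t\<^sup>2 / 2) *\<^sub>R s) - (t *\<^sub>R blinfun_apply (G' zb) v + (t\<^sup>2 / 2) *\<^sub>R l)) \<le> e * t\<^sup>2"
proof -
  interpret G2: bounded_linear G2 by (rule has_derivative_bounded_linear[OF G'_der])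
  define \<gamma> where "\<gamma> t = zb + t *\<^sub>R v - (t\<^sup>2 / 2) *\<^sub>R s" for t :: real
  have \<gamma>der: "(\<gamma> has_derivative (\<lambda>d. d *\<^sub>R (v - t *\<^sub>R s))) (at t)" for t
    unfolding \<gamma>_def by (auto intro!: derivative_eq_intros simp: algebra_simps)
  have \<gamma>0: "\<gamma> 0 = zb" by (simp add: \<gamma>_def)
  \<comment> \<open>The derivative of the remainder \<open>\<psi>\<close> along the curve. It
    vanishes at \<open>0\<close>, and so does its own derivative, because
    \<open>G2 v v - G' zb s - l = 0\<close>.\<close>
  define P where "P t = blinfun_apply (G' (\<gamma> t)) (v - t *\<^sub>R s) - blinfun_apply (G' zb) v - t *\<^sub>R l" for t
  have "((\<lambda>t. G' (\<gamma> t)) has_derivative (\<lambda>d. G2 (d *\<^sub>R v))) (at 0)"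
    using has_derivative_compose[OF \<gamma>der[of 0], of G' G2] G'_der by (simp add: \<gamma>0)
  then have "(P has_derivative (\<lambda>d. 0)) (at 0)"
    unfolding P_def
    by (auto intro!: derivative_eq_intros simp: \<gamma>0 G2.scaleR blinfun.bilinear_simps s fun_eq_iff algebra_simps)
  then obtain \<delta>1 where \<delta>1: "\<delta>1 > 0" "\<And>t. \<bar>t\<bar> < \<delta>1 \<Longrightarrow> norm (P t) \<le> e * \<bar>t\<bar>"
    using e unfolding has_derivative_at_alt by (auto simp: P_def \<gamma>0)
  have "isCont \<gamma> 0" by (rule has_derivative_continuous[OF \<gamma>der])
  then have "\<forall>\<^sub>F t in at 0. \<gamma> t \<in> U"
    using topological_tendstoD[OF _ open_U, of \<gamma> "\<gamma> 0" "at 0"] zb_U \<gamma>0 by (auto simp: isCont_def)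
  then obtain \<delta>2 where \<delta>2: "\<delta>2 > 0" "\<And>t. t \<noteq> 0 \<Longrightarrow> \<bar>t\<bar> < \<delta>2 \<Longrightarrow> \<gamma> t \<in> U"
    unfolding eventually_at by (auto simp: dist_real_def)
  have \<gamma>U: "\<gamma> t \<in> U" if "\<bar>t\<bar> < \<delta>2" for t
    using that \<delta>2(2)[of t] zb_U \<gamma>0 by (cases "t = 0") auto
  define \<psi> where "\<psi> t = G (\<gamma> t) - (t *\<^sub>R blinfun_apply (G' zb) v + (t\<^sup>2 / 2) *\<^sub>R l)" for t
  have \<psi>der: "(\<psi> has_derivative (\<lambda>d. d *\<^sub>R P t)) (at t)" if "\<bar>t\<bar> < \<delta>2" for t
  proof -
    have "((\<lambda>t. G (\<gamma> t)) has_derivative (\<lambda>d. blinfun_apply (G' (\<gamma> t)) (d *\<^sub>R (v - t *\<^sub>R s)))) (at t)"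
      by (rule has_derivative_compose[OF \<gamma>der G_der[OF \<gamma>U[OF that]]])
    then show ?thesis
      unfolding \<psi>_def
      by (auto intro!: derivative_eq_intros simp: P_def blinfun.bilinear_simps algebra_simps)
  qed
  have "norm (\<psi> t) \<le> e * t\<^sup>2" if t: "0 < t" "t < min \<delta>1 \<delta>2" for t
  proof -
    have "norm (\<psi> t - \<psi> 0) \<le> (e * t) * norm (t - 0)"
    proof (rule differentiable_bound[where S = "{0..t}" and f = \<psi>
        and f' = "\<lambda>\<tau> d. d *\<^sub>R P \<tau>" and x = t and y = 0 and B = "e * t"])
      fix \<tau> assume \<tau>: "\<tau> \<in> {0..t}"
      show "(\<psi> has_derivative (\<lambda>d. d *\<^sub>R P \<tau>)) (at \<tau> within {0..t})"
        by (rule has_derivative_at_withinI[OF \<psi>der]) (use \<tau> t in auto)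
      have "norm (P \<tau>) \<le> e * \<bar>\<tau>\<bar>" using \<tau> t by (intro \<delta>1(2)) auto
      also have "\<dots> \<le> e * t" using \<tau> e by simp
      finally show "onorm (\<lambda>d. d *\<^sub>R P \<tau>) \<le> e * t"
        using e t by (intro onorm_bound) (simp_all add: mult.commute mult_left_mono)
    qed (use t in auto)
    then show ?thesis using t by (simp add: \<psi>_def \<gamma>0 G_zb power2_eq_square mult.assoc)
  qed
  then show ?thesis using \<delta>1(1) \<delta>2(1) by (intro exI[of _ "min \<delta>1 \<delta>2"]) (simp add: \<psi>_def \<gamma>_def)
qed

text \<open>The penalized minimization is run along the second-order curve with multipliers
  \<open>\<mu> + t k *\<^sub>R \<nu>\<close>. Second-order accuracy makes the minimizers
  \<open>o(t k)\<close> close to the curve, so their penalty gradients disappear after division by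
  \<open>t k\<close>.\<close>

lemma graph_deriv_inner:
  assumes vL: "blinfun_apply (G' zb) v \<in> lin_space K"
    and s: "G2 v v = blinfun_apply (G' zb) s + l" "l \<in> lin_space K"
    and \<mu>: "\<mu> \<in> polar K" "badj A \<mu> = xs" and \<nu>: "\<epsilon> > 0" "\<mu> + \<epsilon> *\<^sub>R \<nu> \<in> polar K"
  shows "badj (G2 v o\<^sub>L inr_blinfun) \<mu> + badj A \<nu> \<in> graph_deriv \<Psi> zb xs v"
proof -
  obtain \<rho> M where \<rho>: "\<rho> > 0" "M \<ge> 0" "cball pb \<rho> \<times> cball xb \<rho> \<subseteq> U"
    "\<And>z. z \<in> cball pb \<rho> \<times> cball xb \<rho> \<Longrightarrow> norm (G' z) \<le> M" by (rule local_bounds) blast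
  obtain q u where v: "v = (q, u)" by (cases v)
  obtain sp sx where s': "s = (sp, sx)" by (cases s)
  define t where "t k = inverse (real (Suc k))" for k
  have t: "t k > 0" for k by (simp add: t_def)
  have t0: "t \<longlonglongrightarrow> 0" unfolding t_def by (rule LIMSEQ_inverse_real_of_nat)
  define p where "p k = pb + t k *\<^sub>R q - ((t k)\<^sup>2 / 2) *\<^sub>R sp" for k
  define x0 where "x0 k = xb + t k *\<^sub>R u - ((t k)\<^sup>2 / 2) *\<^sub>R sx" for k
  define L where "L k = t k *\<^sub>R blinfun_apply (G' zb) v + ((t k)\<^sup>2 / 2) *\<^sub>R l" for k
  have LL: "L k \<in> lin_space K" for k
    unfolding L_def using subspace_lin_space[OF K(2-4)] vL s(2)
    by (intro subspace_add subspace_scale)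
  have curve: "(p k, x0 k) = zb + t k *\<^sub>R v - ((t k)\<^sup>2 / 2) *\<^sub>R s" for k
    by (simp add: p_def x0_def v s')
  define R where "R k = norm (G (p k, x0 k) - L k) / (t k)\<^sup>2" for k
  have R0: "R \<longlonglongrightarrow> 0"
  proof (rule LIMSEQ_I)
    fix e :: real assume "e > 0"
    then obtain \<delta> where \<delta>: "\<delta> > 0" "\<And>t. 0 < t \<Longrightarrow> t < \<delta> \<Longrightarrow>
      norm (G (zb + t *\<^sub>R v - (t\<^sup>2 / 2) *\<^sub>R s) - (t *\<^sub>R blinfun_apply (G' zb) v + (t\<^sup>2 / 2) *\<^sub>R l)) \<le> e / 2 * t\<^sup>2"
      using second_order_curve[OF s(1), of "e / 2"] by auto
    obtain N where "\<And>k. k \<ge> N \<Longrightarrow> t k < \<delta>"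
      using order_tendstoD(2)[OF t0 \<delta>(1)] by (auto simp: eventually_sequentially)
    then have "R k \<le> e / 2" if "k \<ge> N" for k
      using \<delta>(2)[OF t[of k]] t[of k] that by (simp add: R_def curve L_def divide_le_eq)
    moreover have "norm (R k - 0) = R k" for k by (simp add: R_def)
    ultimately show "\<exists>N. \<forall>k\<ge>N. norm (R k - 0) < e"
      using \<open>e > 0\<close> by (metis field_sum_of_halves le_less_trans less_add_same_cancel1 half_gt_zero)
  qed
  \<comment> \<open>The summand \<open>t k\<close> makes the tolerance strictly positive even if the
    curve hits the lineality space exactly, while \<open>d k / (t k)\<^sup>2\<close> still tends to
    \<open>0\<close>.\<close>
  define d where "d k = (R k + t k) * (t k)\<^sup>2" for k
  have dpos: "d k > 0" for k using t[of k] by (auto simp: d_def R_def intro!: mult_pos_pos add_nonneg_pos)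
  have dle: "norm (G (p k, x0 k) - L k) \<le> d k" for k
    using t[of k] by (simp add: d_def R_def field_simps)
  have d0: "d \<longlonglongrightarrow> 0" and dt0: "(\<lambda>k. d k / (t k)\<^sup>2) \<longlonglongrightarrow> 0"
  proof -
    have "d \<longlonglongrightarrow> (0 + 0) * 0\<^sup>2" unfolding d_def by (intro tendsto_intros R0 t0)
    then show "d \<longlonglongrightarrow> 0" by simp
    have "d k / (t k)\<^sup>2 = R k + t k" for k using t[of k] by (simp add: d_def)
    then show "(\<lambda>k. d k / (t k)\<^sup>2) \<longlonglongrightarrow> 0" using tendsto_add[OF R0 t0] by simp
  qed
  define m where "m k = \<mu> + t k *\<^sub>R \<nu>" for k
  have m\<mu>: "m \<longlonglongrightarrow> \<mu>" unfolding m_def using tendsto_add[OF tendsto_const tendsto_scaleR[OF t0 tendsto_const]] by force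
  \<comment> \<open>For \<open>t k \<le> \<epsilon>\<close> the point \<open>m k\<close> lies on the
    segment from \<open>\<mu>\<close> to \<open>\<mu> + \<epsilon> *\<^sub>R \<nu>\<close>; the
    computation multiplies by \<open>\<epsilon>\<close> to avoid fractions.\<close>
  have mpol: "m k \<in> polar K" if "t k \<le> \<epsilon>" for k
  proof -
    have "inner (m k) a \<le> 0" if "a \<in> K" for a
    proof -
      have "\<epsilon> * inner (m k) a = (\<epsilon> - t k) * inner \<mu> a + t k * inner (\<mu> + \<epsilon> *\<^sub>R \<nu>) a"
        by (simp add: m_def inner_simps algebra_simps)
      also have "\<dots> \<le> 0" using \<mu>(1) \<nu>(2) that \<open>t k \<le> \<epsilon>\<close> t[of k]
        by (intro add_nonpos_nonpos mult_nonneg_nonpos) (auto simp: polar_def)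
      finally show ?thesis using \<nu>(1) by (simp add: mult_le_0_iff)
    qed
    then show ?thesis by (simp add: polar_def)
  qed
  define E where "E k = norm (m k) * ((M * (\<kappa> + 1) + 1) * d k) + ((\<kappa> + 1) * d k)\<^sup>2" for k
  have "E \<longlonglongrightarrow> norm \<mu> * ((M * (\<kappa> + 1) + 1) * 0) + ((\<kappa> + 1) * 0)\<^sup>2"
    unfolding E_def by (intro tendsto_intros m\<mu> d0)
  then have E0: "E \<longlonglongrightarrow> 0" by simp
  \<comment> \<open>\<open>E\<close> bounds the squared distance and is of first order in
    \<open>d\<close>. This is why the curve must approach the lineality space at rate
    \<open>o(t\<^sup>2)\<close>.\<close>
  have Et0: "(\<lambda>k. E k / (t k)\<^sup>2) \<longlonglongrightarrow> 0"
  proof -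
    have "(\<lambda>k. norm (m k) * ((M * (\<kappa> + 1) + 1) * (d k / (t k)\<^sup>2)) + (\<kappa> + 1)\<^sup>2 * (d k * (d k / (t k)\<^sup>2)))
      \<longlonglongrightarrow> norm \<mu> * ((M * (\<kappa> + 1) + 1) * 0) + (\<kappa> + 1)\<^sup>2 * (0 * 0)"
      by (intro tendsto_intros m\<mu> d0 dt0)
    moreover have "E k / (t k)\<^sup>2 =
      norm (m k) * ((M * (\<kappa> + 1) + 1) * (d k / (t k)\<^sup>2)) + (\<kappa> + 1)\<^sup>2 * (d k * (d k / (t k)\<^sup>2))" for k
      by (simp add: E_def add_divide_distrib power2_eq_square mult_ac)
    ultimately show ?thesis by simp
  qed
  have x0lim: "(\<lambda>k. norm (x0 k - xb)) \<longlonglongrightarrow> 0"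
  proof -
    have "(\<lambda>k. norm (t k *\<^sub>R u - ((t k)\<^sup>2 / 2) *\<^sub>R sx)) \<longlonglongrightarrow> norm (0 *\<^sub>R u - (0\<^sup>2 / 2) *\<^sub>R sx)"
      by (intro tendsto_intros t0) auto
    then show ?thesis by (simp add: x0_def)
  qed
  have plim: "(\<lambda>k. dist pb (p k)) \<longlonglongrightarrow> 0"
  proof -
    have "(\<lambda>k. norm (t k *\<^sub>R q - ((t k)\<^sup>2 / 2) *\<^sub>R sp)) \<longlonglongrightarrow> norm (0 *\<^sub>R q - (0\<^sup>2 / 2) *\<^sub>R sp)"
      by (intro tendsto_intros t0) auto
    moreover have "dist pb (p k) = norm (t k *\<^sub>R q - ((t k)\<^sup>2 / 2) *\<^sub>R sp)" for k
      by (simp add: p_def dist_norm norm_minus_commute algebra_simps)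
    ultimately show ?thesis by simp
  qed
  define good where "good k x \<longleftrightarrow> x \<in> \<Gamma> (p k) \<and> (norm (x - x0 k))\<^sup>2 \<le> E k \<and>
    badj (G' (p k, x) o\<^sub>L inr_blinfun) (m k) - 2 *\<^sub>R (x - x0 k) \<in> normal_cone (\<Gamma> (p k)) x" for k x
  have "(\<lambda>k. (\<kappa> + 1) * d k) \<longlonglongrightarrow> 0" using tendsto_mult[OF tendsto_const d0, of "\<kappa> + 1"] by simp
  then have "\<forall>\<^sub>F k in sequentially. t k < \<epsilon> \<and> dist pb (p k) < \<rho> \<and> norm (x0 k - xb) < \<rho> / 2 \<and>
      (\<kappa> + 1) * d k < \<rho> / 2 \<and> E k < (\<rho> / 2)\<^sup>2"
    using \<rho>(1) \<nu>(1) by (intro eventually_conj order_tendstoD(2)[OF t0] order_tendstoD(2)[OF plim]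
      order_tendstoD(2)[OF x0lim] order_tendstoD(2)[OF E0] order_tendstoD(2)) auto
  then have ev: "\<forall>\<^sub>F k in sequentially. \<exists>x. good k x"
  proof eventually_elim
    case (elim k)
    have "\<exists>x. x \<in> \<Gamma> (p k) \<and> (norm (x - x0 k))\<^sup>2 \<le> E k \<and> norm (x - xb) < \<rho> \<and>
      badj (G' (p k, x) o\<^sub>L inr_blinfun) (m k) - 2 *\<^sub>R (x - x0 k) \<in> normal_cone (\<Gamma> (p k)) x"
      by (rule normal_near_lineality[OF \<rho> mpol _ _ LL dpos dle _ E_def]) (use elim in auto)
    then show ?case by (auto simp: good_def)
  qed
  \<comment> \<open>The default \<open>x0 k\<close> only fills the finitely many indices without a
    good point.\<close>
  define x where "x k = (if \<exists>x. good k x then SOME x. good k x else x0 k)" for k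
  have ev: "\<forall>\<^sub>F k in sequentially. good k (x k)"
    using ev by eventually_elim (auto simp: x_def intro: someI_ex)
  define y where "y k = (x k - x0 k) /\<^sub>R t k" for k
  have y0: "y \<longlonglongrightarrow> 0"
  proof -
    have "\<forall>\<^sub>F k in sequentially. norm ((norm (y k))\<^sup>2) \<le> E k / (t k)\<^sup>2"
      using ev
    proof eventually_elim
      case (elim k)
      have "(norm (y k))\<^sup>2 = (norm (x k - x0 k))\<^sup>2 / (t k)\<^sup>2"
        using t[of k] by (simp add: y_def power_mult_distrib divide_inverse power_inverse mult.commute)
      then show ?case using elim t[of k] by (simp add: good_def divide_right_mono)
    qed
    then have "(\<lambda>k. (norm (y k))\<^sup>2) \<longlonglongrightarrow> 0" using Et0 by (rule Lim_null_comparison)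
    then have "(\<lambda>k. sqrt ((norm (y k))\<^sup>2)) \<longlonglongrightarrow> sqrt 0" by (rule tendsto_real_sqrt)
    then show ?thesis by (simp add: tendsto_norm_zero_iff)
  qed
  \<comment> \<open>The direction from the reference point to \<open>(p k, x k)\<close>, rescaled by
    \<open>t k\<close>; it absorbs both the second-order term and the minimization error.\<close>
  define V where "V k = v - (t k / 2) *\<^sub>R s + (0, y k)" for k
  have V: "V \<longlonglongrightarrow> v"
  proof -
    have "V \<longlonglongrightarrow> v - (0 / 2) *\<^sub>R s + (0, 0)" unfolding V_def by (intro tendsto_intros t0 y0) auto
    then show ?thesis by (simp add: zero_prod_def[symmetric])
  qed
  have ZV: "zb + t k *\<^sub>R V k = (p k, x k)" for k
  proof -
    have "t k *\<^sub>R y k = x k - x0 k" using t[of k] by (simp add: y_def)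
    then show ?thesis
      by (simp add: V_def v s' p_def x0_def power2_eq_square algebra_simps)
  qed
  let ?D = "\<lambda>k. ((G' (zb + t k *\<^sub>R V k) - G' zb) /\<^sub>R t k) o\<^sub>L inr_blinfun"
  define W where "W k = badj (?D k) (m k) + badj A \<nu> - 2 *\<^sub>R y k" for k
  have "W \<longlonglongrightarrow> badj (G2 v o\<^sub>L inr_blinfun) \<mu> + badj A \<nu> - 2 *\<^sub>R 0"
    unfolding W_def by (intro tendsto_intros badj.tendsto m\<mu> y0 G'_quotient t t0 V)
  then have W: "W \<longlonglongrightarrow> badj (G2 v o\<^sub>L inr_blinfun) \<mu> + badj A \<nu>" by simp
  have vec: "xs + t k *\<^sub>R W k = badj (G' (p k, x k) o\<^sub>L inr_blinfun) (m k) - 2 *\<^sub>R (x k - x0 k)" for k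
  proof -
    have "G' (zb + t k *\<^sub>R V k) o\<^sub>L inr_blinfun = t k *\<^sub>R ?D k + A"
      using t[of k] by (intro blinfun_eqI) (simp add: A_def blinfun.bilinear_simps)
    then have "badj (G' (p k, x k) o\<^sub>L inr_blinfun) (m k) = t k *\<^sub>R badj (?D k) (m k) + badj A (m k)"
      unfolding ZV by (simp add: badj.add_left badj.scaleR_left)
    moreover have "badj A (m k) = xs + t k *\<^sub>R badj A \<nu>"
      by (simp add: m_def badj.add_right badj.scaleR_right \<mu>(2))
    moreover have "t k *\<^sub>R 2 *\<^sub>R y k = 2 *\<^sub>R (x k - x0 k)" using t[of k] by (simp add: y_def)
    ultimately show ?thesis
      by (simp add: W_def scaleR_add_right scaleR_diff_right del: scaleR_scaleR)
  qed
  have "(v, badj (G2 v o\<^sub>L inr_blinfun) \<mu> + badj A \<nu>) \<in> tangent_cone (gph \<Psi>) (zb, xs)"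
  proof (rule tangent_coneI_eventually[OF t t0 tendsto_Pair[OF V W]])
    show "\<forall>\<^sub>F k in sequentially. (zb, xs) + t k *\<^sub>R (V k, W k) \<in> gph \<Psi>"
      using ev
    proof eventually_elim
      case (elim k)
      have "(zb, xs) + t k *\<^sub>R (V k, W k) = ((p k, x k), xs + t k *\<^sub>R W k)"
        using ZV[of k] by simp
      then show ?case using elim unfolding vec by (simp add: gph_def \<Psi>_def good_def)
    qed
  qed
  then show ?thesis by (simp add: graph_deriv_def)
qed

end

section \<open>Cone-reducible systems\<close>

lemma C2_nearE:
  assumes "C2_near f a"
  obtains U D2 where "open U" "a \<in> U"
    "\<And>z. z \<in> U \<Longrightarrow> (f has_derivative blinfun_apply (Dbl f z)) (at z)"
    "(Dbl f has_derivative D2) (at a)"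
proof -
  obtain U where U: "open U" "a \<in> U" "\<forall>w\<in>U. f differentiable at w" "\<forall>w\<in>U. Dbl f differentiable at w"
    using assms unfolding C2_near_def by blast
  have "(f has_derivative blinfun_apply (Dbl f z)) (at z)" if "z \<in> U" for z
  proof -
    have "(f has_derivative frechet_derivative f (at z)) (at z)"
      using U(3) that frechet_derivative_works by blast
    then show ?thesis
      unfolding Dbl_def by (simp add: bounded_linear_Blinfun_apply has_derivative_bounded_linear)
  qed
  moreover have "(Dbl f has_derivative frechet_derivative (Dbl f) (at a)) (at a)"
    using U frechet_derivative_works by blast
  ultimately show ?thesis using that U by blast
qed

lemma frechet_derivative_Dbl:
  "(f has_derivative blinfun_apply (Dbl f z)) (at z) \<Longrightarrow> frechet_derivative f (at z) = blinfun_apply (Dbl f z)"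
  by (rule frechet_derivative_at[symmetric])

lemma adjoint_frechet_derivative:
  "(f has_derivative blinfun_apply (Dbl f z)) (at z) \<Longrightarrow> adjoint (frechet_derivative f (at z)) = badj (Dbl f z)"
  by (simp add: frechet_derivative_Dbl badj_def fun_eq_iff)

lemma Dx_Dbl:
  "(f has_derivative blinfun_apply (Dbl f z)) (at z) \<Longrightarrow> Dx f z = blinfun_apply (Dbl f z o\<^sub>L inr_blinfun)"
  by (simp add: Dx_def fun_eq_iff frechet_derivative_Dbl)

lemma adjoint_Dx:
  "(f has_derivative blinfun_apply (Dbl f z)) (at z) \<Longrightarrow> adjoint (Dx f z) = badj (Dbl f z o\<^sub>L inr_blinfun)"
  by (simp add: Dx_Dbl badj_def fun_eq_iff)

text \<open>The derivative expressions of the theorem are matched with \<open>badj\<close> formulas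
  at points where the map is known to be differentiable; agreement on a neighbourhood suffices to
  differentiate once more.\<close>

lemma frechet_derivative_on_open:
  assumes "open U" "a \<in> U" "(f has_derivative D) (at a)" "\<And>z. z \<in> U \<Longrightarrow> F z = f z"
  shows "frechet_derivative F (at a) = D"
proof -
  have "(F has_derivative D) (at a)"
    by (rule has_derivative_transform_within_open[OF assms(3,1,2)]) (simp add: assms(4))
  then show ?thesis by (rule frechet_derivative_at[symmetric])
qed

section \<open>Distances and normal cones under the reduction map\<close>

lemma infdist_approx:
  assumes "S \<noteq> {}" "e > 0"
  shows "\<exists>s\<in>S. dist x s \<le> infdist x S + e"
proof -
  have "Inf (dist x ` S) < infdist x S + e" using assms by (simp add: infdist_notempty)
  from cInf_lessD[OF _ this] assms(1) show ?thesis by force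
qed

text \<open>One inclusion is the bounded multiplier result with \<open>S = C\<close> and
  \<open>F = h\<close>. For the other, \<open>y0\<close> minimizes
  \<open>- inner \<mu> (h y)\<close> over \<open>C\<close> locally, since values of \<open>h\<close>
  on \<open>C\<close> near \<open>y0\<close> lie in \<open>K\<close>.\<close>

lemma normal_cone_reduced:
  fixes h :: "'y::euclidean_space \<Rightarrow> 'e::euclidean_space"
  assumes K: "closed K" "convex K" "cone K" and N: "open N" "y0 \<in> N" "\<And>y. y \<in> N \<Longrightarrow> y \<in> C \<longleftrightarrow> h y \<in> K"
    and h0: "h y0 = 0" "0 \<in> K" and der: "(h has_derivative blinfun_apply H) (at y0)"
    and c: "c \<ge> 0" "\<And>y k. y \<in> N \<Longrightarrow> k \<in> K \<Longrightarrow> infdist y C \<le> c * dist (h y) k"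
  shows "normal_cone C y0 = badj H ` polar K"
proof (intro equalityI subsetI)
  fix lam assume l: "lam \<in> normal_cone C y0"
  have "C \<noteq> {}" using N(3)[OF N(2)] h0 by auto
  then have "\<exists>s\<in>C. dist y s \<le> c * dist (h y) k + e" if "y \<in> N" "k \<in> K" "e > 0" for y k e
    using infdist_approx[of C e y] c(2)[OF that(1,2)] that(3) by force
  then have "\<exists>\<mu>\<in>polar K. inner \<mu> (h y0) = 0 \<and> norm \<mu> \<le> c * norm lam \<and> badj H \<mu> = lam"
    using h0 by (intro bounded_multiplier_exists[OF K _ der l c(1) N(1,2)]) auto
  then show "lam \<in> badj H ` polar K" by blast
next
  fix lam assume "lam \<in> badj H ` polar K"
  then obtain \<mu> where \<mu>: "\<mu> \<in> polar K" "lam = badj H \<mu>" by blast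
  obtain d where d: "d > 0" "ball y0 d \<subseteq> N" using N open_contains_ball by blast
  show "lam \<in> normal_cone C y0"
  proof (rule local_min_normal_cone[where f = "\<lambda>y. - inner \<mu> (h y)", OF _ d(1)])
    show "y0 \<in> C" using N h0 by simp
    show "- inner \<mu> (h y0) \<le> - inner \<mu> (h y)" if "y \<in> C" "norm (y - y0) < d" for y
    proof -
      have "y \<in> N" using d that by (auto simp: dist_norm norm_minus_commute)
      then show ?thesis using N(3) that(1) \<mu>(1) h0 by (auto simp: polar_def)
    qed
    show "((\<lambda>y. - inner \<mu> (h y)) has_derivative (\<lambda>w. - inner lam w)) (at y0)"
      unfolding \<mu>(2) inner_badj by (rule derivative_eq_intros der refl)+ simp
  qed
qed

text \<open>Solving \<open>h y' = k\<close> near \<open>y\<close> produces a point of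
  \<open>C\<close>, provided \<open>y'\<close> remains where \<open>C\<close> is described by
  \<open>h\<close>. Hence the distance to \<open>C\<close> is controlled by the distance of
  \<open>h y\<close> to \<open>k\<close>.\<close>

lemma cone_reducible_error_bound:
  assumes "cone_reducible C y0 h K" "h y0 \<in> K"
  obtains c N where "c \<ge> 0" "open N" "y0 \<in> N" "\<And>y. y \<in> N \<Longrightarrow> y \<in> C \<longleftrightarrow> h y \<in> K"
    "\<And>y k. y \<in> N \<Longrightarrow> k \<in> K \<Longrightarrow> infdist y C \<le> c * dist (h y) k"
proof -
  obtain V where V: "open V" "y0 \<in> V" "C2_near h y0" "h y0 = 0"
    "surj (frechet_derivative h (at y0))" "C \<inter> V = {y\<in>V. h y \<in> K}"
    using assms(1) unfolding cone_reducible_def by blast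
  obtain Uh h2 where Uh: "open Uh" "y0 \<in> Uh"
    "\<And>z. z \<in> Uh \<Longrightarrow> (h has_derivative blinfun_apply (Dbl h z)) (at z)"
    "(Dbl h has_derivative h2) (at y0)" using C2_nearE[OF V(3)] by metis
  have "isCont (Dbl h) y0" by (rule has_derivative_continuous[OF Uh(4)])
  moreover have "surj (blinfun_apply (Dbl h y0))"
    using V(5) frechet_derivative_Dbl[OF Uh(3)[OF Uh(2)]] by simp
  ultimately obtain c r where c: "c \<ge> 0" "r > 0"
    "\<And>y k. y \<in> ball y0 r \<Longrightarrow> dist (h y) k < r \<Longrightarrow> \<exists>y'. h y' = k \<and> dist y y' \<le> c * dist (h y) k"
    using C1_submersion_solvable[OF Uh(1-3)] by metis
  obtain \<rho> where \<rho>: "\<rho> > 0" "ball y0 \<rho> \<subseteq> V" using V open_contains_ball by blast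
  \<comment> \<open>Chosen so that \<open>c * r' \<le> \<rho> / 2\<close>: the solution then stays
    in the ball of radius \<open>\<rho>\<close>, inside \<open>V\<close>.\<close>
  define r' where "r' = min r (\<rho> / (2 * (c + 1)))"
  have r': "r' > 0" "r' \<le> r" using c \<rho> by (simp_all add: r'_def)
  have "r' \<le> \<rho> / (2 * (c + 1))" by (simp add: r'_def)
  then have "r' * (2 * (c + 1)) \<le> \<rho>" using c(1) by (simp add: pos_le_divide_eq)
  then have cr': "c * r' \<le> \<rho> / 2" using r'(1) by (simp add: algebra_simps)
  define O1 where "O1 = Uh \<inter> ball y0 (min r (\<rho> / 2))"
  define Ob where "Ob = O1 \<inter> h -` ball 0 r'"
  have "continuous_on O1 h"
    by (rule continuous_at_imp_continuous_on) (auto simp: O1_def intro: has_derivative_continuous[OF Uh(3)])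
  moreover have "open O1" using Uh(1) by (auto simp: O1_def)
  ultimately have "open Ob" unfolding Ob_def by (intro continuous_open_preimage) auto
  moreover have "y0 \<in> Ob" using Uh(2) c(2) \<rho>(1) r' V(4) by (simp add: Ob_def O1_def)
  moreover have CV: "y \<in> C \<longleftrightarrow> h y \<in> K" if "y \<in> ball y0 \<rho>" for y
  proof -
    have "y \<in> V" using that \<rho>(2) by blast
    then show ?thesis using V(6) by blast
  qed
  moreover have "Ob \<subseteq> ball y0 \<rho>" using \<rho>(1) by (auto simp: Ob_def O1_def)
  moreover have "infdist y C \<le> c * dist (h y) k" if y: "y \<in> Ob" and k: "k \<in> K" for y k
  proof -
    \<comment> \<open>A target at distance \<open>r'\<close> or more is replaced by
      \<open>0\<close>, which belongs to \<open>K\<close> and is no farther from \<open>h y\<close>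
      because \<open>norm (h y) < r'\<close>.\<close>
    define k' where "k' = (if dist (h y) k < r' then k else 0)"
    have hy: "norm (h y) < r'" using y by (simp add: Ob_def)
    have k': "k' \<in> K" "dist (h y) k' < r'" "dist (h y) k' \<le> dist (h y) k"
      using k hy assms(2) V(4) by (auto simp: k'_def)
    have yb: "y \<in> ball y0 r" "dist y0 y < \<rho> / 2" using y by (auto simp: Ob_def O1_def)
    obtain y' where y': "h y' = k'" "dist y y' \<le> c * dist (h y) k'"
      using c(3)[OF yb(1), of k'] k'(2) r'(2) by auto
    have "c * dist (h y) k' \<le> c * r'" using k'(2) c(1) by (intro mult_left_mono) auto
    then have "dist y0 y' < \<rho>" using dist_triangle[of y0 y' y] yb(2) y'(2) cr' by linarith
    then have "y' \<in> C" using CV[of y'] y'(1) k'(1) by simp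
    then have "infdist y C \<le> dist y y'" by (rule infdist_le)
    also have "\<dots> \<le> c * dist (h y) k'" by (rule y')
    also have "\<dots> \<le> c * dist (h y) k" using k'(3) c(1) by (rule mult_left_mono)
    finally show ?thesis .
  qed
  ultimately show ?thesis using that[OF c(1), of Ob] by blast
qed

section \<open>Both inclusions in terms of the original system\<close>

theorem theorem5p6:
  fixes g :: "'p::euclidean_space \<times> 'x::euclidean_space \<Rightarrow> 'y::euclidean_space"
    and C :: "'y set" and h :: "'y \<Rightarrow> 'e::euclidean_space" and K :: "'e set"
    and pb :: 'p and xb :: 'x and xs :: 'x
  assumes g_C2: "C2_near g (pb, xb)"
    and C_closed: "closed C"
    and feas: "g (pb, xb) \<in> C"
    and reducible: "cone_reducible C (g (pb, xb)) h K"
    and xs_normal: "xs \<in> normal_cone (Gamma g C pb) xb"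
    and robinson: "robinson_stable g C pb xb"
    and strict: "strict_compl g C pb xb xs"
    and q_in: "q \<in> char_subspace g h K (pb, xb)"
  shows "graph_deriv (Psi g C) (pb, xb) xs (q, u) \<subseteq> rhs_set g C h (pb, xb) xs (q, u)
    \<and> (second_order_cond g h K (pb, xb) (q, u) \<longrightarrow>
         graph_deriv (Psi g C) (pb, xb) xs (q, u) = rhs_set g C h (pb, xb) xs (q, u))
    \<and> (surj (frechet_derivative g (at (pb, xb))) \<longrightarrow> second_order_cond g h K (pb, xb) (q, u))"
proof -
  let ?z = "(pb, xb)"
  let ?y = "g ?z"
  let ?v = "(q, u)"
  obtain Ug g2 where Ug: "open Ug" "?z \<in> Ug"
    "\<And>z. z \<in> Ug \<Longrightarrow> (g has_derivative blinfun_apply (Dbl g z)) (at z)"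
    "(Dbl g has_derivative g2) (at ?z)" using C2_nearE[OF g_C2] by metis
  obtain V where V: "open V" "?y \<in> V" "C2_near h ?y" "h ?y = 0"
    "surj (frechet_derivative h (at ?y))" "C \<inter> V = {y\<in>V. h y \<in> K}"
    and K: "closed K" "convex K" "cone K"
    using reducible unfolding cone_reducible_def by blast
  obtain Uh h2 where Uh: "open Uh" "?y \<in> Uh"
    "\<And>z. z \<in> Uh \<Longrightarrow> (h has_derivative blinfun_apply (Dbl h z)) (at z)"
    "(Dbl h has_derivative h2) (at ?y)" using C2_nearE[OF V(3)] by metis
  have "h ?y \<in> K" using V feas by blast
  then have K0: "0 \<in> K" using V(4) by simp
  note K = K K0
  obtain c Ob where c: "c \<ge> 0" and Ob: "open Ob" "?y \<in> Ob" "\<And>y. y \<in> Ob \<Longrightarrow> y \<in> C \<longleftrightarrow> h y \<in> K"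
    "\<And>y k. y \<in> Ob \<Longrightarrow> k \<in> K \<Longrightarrow> infdist y C \<le> c * dist (h y) k"
    using cone_reducible_error_bound[OF reducible \<open>h ?y \<in> K\<close>] by metis
  obtain \<kappa> W X where \<kappa>: "\<kappa> \<ge> 0" and WX: "open W" "pb \<in> W" "open X" "xb \<in> X"
    "\<And>p x. p \<in> W \<Longrightarrow> x \<in> X \<Longrightarrow> Gamma g C p \<noteq> {} \<and> infdist x (Gamma g C p) \<le> \<kappa> * infdist (g (p, x)) C"
    using robinson unfolding robinson_stable_def by blast
  define g' where "g' = Dbl g ?z"
  define h' where "h' = Dbl h ?y"
  note g_der = Ug(3)[OF Ug(2), folded g'_def] and h_der = Uh(3)[OF Uh(2), folded h'_def]
  define G' where "G' z = Dbl h (g z) o\<^sub>L Dbl g z" for z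
  \<comment> \<open>The chain and product rules applied to
    \<open>Dbl h (g z) o\<^sub>L Dbl g z\<close>: one term differentiates the outer factor, the
    other the inner one.\<close>
  define G2 where "G2 w = (h2 (blinfun_apply g' w) o\<^sub>L g') + (h' o\<^sub>L g2 w)" for w
  define U where "U = (Ug \<inter> g -` (Ob \<inter> Uh)) \<inter> (W \<times> X)"
  have "continuous_on Ug g"
    by (rule continuous_at_imp_continuous_on) (blast intro: has_derivative_continuous[OF Ug(3)])
  then have "open U"
    unfolding U_def using Ug(1) Ob(1) Uh(1) WX by (intro open_Int continuous_open_preimage open_Times) auto
  have zU: "?z \<in> U" using Ug(2) Ob(2) Uh(2) WX by (simp add: U_def)
  have G_der: "(h \<circ> g has_derivative blinfun_apply (G' z)) (at z)" if "z \<in> U" for z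
  proof -
    have "(h \<circ> g has_derivative blinfun_apply (Dbl h (g z)) \<circ> blinfun_apply (Dbl g z)) (at z)"
      using that by (intro diff_chain_at Ug(3) Uh(3)) (auto simp: U_def)
    then show ?thesis by (simp add: G'_def blinfun_compose.rep_eq)
  qed
  have G'_der: "(G' has_derivative G2) (at ?z)"
  proof -
    have "((\<lambda>z. Dbl h (g z)) has_derivative (\<lambda>w. h2 (blinfun_apply g' w))) (at ?z)"
      by (rule has_derivative_compose[OF g_der Uh(4)])
    from bounded_bilinear.FDERIV[OF bounded_bilinear_blinfun_compose this Ug(4)]
    show ?thesis unfolding G'_def G2_def g'_def h'_def by (simp add: add.commute)
  qed
  \<comment> \<open>Robinson stability bounds the distance to the feasible set by
    \<open>\<kappa>\<close> times the distance to \<open>C\<close>, which the reduction bounds with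
    factor \<open>c\<close>; hence the constant \<open>\<kappa> * c\<close>.\<close>
  interpret reduced_system "h \<circ> g" G' G2 K "Gamma g C" U "\<kappa> * c" pb xb
  proof
    show "x \<in> Gamma g C p \<longleftrightarrow> (h \<circ> g) (p, x) \<in> K" if "(p, x) \<in> U" for p x
      using that Ob(3) by (simp add: Gamma_def U_def)
    show "\<exists>x'\<in>Gamma g C p. dist x x' \<le> \<kappa> * c * dist ((h \<circ> g) (p, x)) k + e"
      if *: "(p, x) \<in> U" "k \<in> K" "e > 0" for p x k e
    proof -
      have WX': "Gamma g C p \<noteq> {}" "infdist x (Gamma g C p) \<le> \<kappa> * infdist (g (p, x)) C"
        using WX(5)[of p x] *(1) by (auto simp: U_def)
      have "\<kappa> * infdist (g (p, x)) C \<le> \<kappa> * (c * dist (h (g (p, x))) k)"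
        using * \<kappa> by (intro mult_left_mono Ob(4)) (auto simp: U_def)
      then show ?thesis using infdist_approx[OF WX'(1) *(3), of x] WX'(2) by (force simp: mult.assoc)
    qed
  qed (use \<open>open U\<close> zU G_der G'_der V(4) K \<kappa> c in auto)
  have G'z: "G' ?z = h' o\<^sub>L g'" by (simp add: G'_def h'_def g'_def)
  have A_eq: "A = h' o\<^sub>L (g' o\<^sub>L inr_blinfun)" unfolding A_def G'z by (rule blinfun_eqI) simp
  have \<Psi>_eq: "Psi g C = \<Psi>" by (simp add: fun_eq_iff Psi_def \<Psi>_def)
  have Tan: "tangent_cone {z. g z \<in> C} ?z = {v. blinfun_apply (G' ?z) v \<in> K}"
    using tangent_cone_graph by (simp add: Gamma_def)
  note [simp] = frechet_derivative_Dbl[OF Ug(3)[OF Ug(2)], folded g'_def]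
    frechet_derivative_Dbl[OF Uh(3)[OF Uh(2)], folded h'_def]
    adjoint_frechet_derivative[OF Ug(3)[OF Ug(2)], folded g'_def]
    adjoint_Dx[OF Ug(3)[OF Ug(2)], folded g'_def]
  have adj_h: "adjoint (blinfun_apply h') = badj h'" and adj_g: "adjoint (blinfun_apply g') = badj g'"
    by (simp_all add: badj_def fun_eq_iff)
  have NC: "normal_cone C ?y = badj h' ` polar K"
    by (rule normal_cone_reduced[OF K(1-3) Ob(1-3) V(4) K0 h_der c Ob(4)])
  have surj_h: "surj (blinfun_apply h')" using V(5) by simp
  \<comment> \<open>Surjectivity of \<open>h'\<close> makes its adjoint injective. This justifies
    the definite description in \<open>mult_E\<close> and lets the relative interior commute with
    the image of the polar.\<close>
  have "inj (badj h')"
  proof (rule injI)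
    fix \<mu> \<mu>' assume "badj h' \<mu> = badj h' \<mu>'"
    then have "inner \<mu> w = inner \<mu>' w" for w
      using surj_h by (metis inner_badj surjD)
    then show "\<mu> = \<mu>'" by (metis vector_eq_rdot)
  qed
  have mult: "mult_E h ?y (badj h' \<mu>) = \<mu>" for \<mu>
    unfolding mult_E_def using \<open>inj (badj h')\<close> by (auto simp: adj_h dest: injD)
  \<comment> \<open>\<open>DxT_deriv\<close> differentiates the factor coming from \<open>g\<close>,
    and \<open>H_op\<close> the factor coming from \<open>h\<close>, so their sum is the full
    derivative of the adjoint partial derivative of \<open>h \<circ> g\<close> applied to the fixed
    \<open>\<mu>\<close>.\<close>
  have deriv_eq: "DxT_deriv g ?z (badj h' \<mu>) w + H_op g h ?z (badj h' \<mu>) w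
      = badj (G2 w o\<^sub>L inr_blinfun) \<mu>" for \<mu> w
  proof -
    have "((\<lambda>z. badj (Dbl g z o\<^sub>L inr_blinfun) (badj h' \<mu>)) has_derivative
        (\<lambda>w. badj (g2 w o\<^sub>L inr_blinfun) (badj h' \<mu>))) (at ?z)"
      by (rule bounded_linear.has_derivative[OF badj.bounded_linear_left]
          bounded_linear.has_derivative[OF bounded_bilinear.bounded_linear_left[OF bounded_bilinear_blinfun_compose]] Ug(4))+
    then have 1: "frechet_derivative (\<lambda>z. adjoint (Dx g z) (badj h' \<mu>)) (at ?z)
        = (\<lambda>w. badj (g2 w o\<^sub>L inr_blinfun) (badj h' \<mu>))"
      by (rule frechet_derivative_on_open[OF Ug(1,2)]) (simp add: adjoint_Dx[OF Ug(3)])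
    have "((\<lambda>y. badj (Dbl h y) \<mu>) has_derivative (\<lambda>w. badj (h2 w) \<mu>)) (at ?y)"
      by (rule bounded_linear.has_derivative[OF badj.bounded_linear_left] Uh(4))+
    then have 2: "frechet_derivative (\<lambda>y. adjoint (frechet_derivative h (at y)) \<mu>) (at ?y) = (\<lambda>w. badj (h2 w) \<mu>)"
      by (rule frechet_derivative_on_open[OF Uh(1,2)]) (simp add: adjoint_frechet_derivative[OF Uh(3)])
    have "G2 w o\<^sub>L inr_blinfun = (h2 (blinfun_apply g' w) o\<^sub>L (g' o\<^sub>L inr_blinfun)) + (h' o\<^sub>L (g2 w o\<^sub>L inr_blinfun))"
      by (rule blinfun_eqI) (simp add: G2_def blinfun.bilinear_simps)
    then show ?thesis
      unfolding DxT_deriv_def H_op_def mult 1 2 by (simp add: badj.add_left badj_compose)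
  qed
  have "\<exists>m\<in>rel_interior (polar K). badj A m = xs"
  proof -
    obtain lam where lam: "lam \<in> rel_interior (normal_cone C ?y)" "adjoint (Dx g ?z) lam = xs"
      using strict unfolding strict_compl_def by blast
    have "rel_interior (badj h' ` polar K) = badj h' ` rel_interior (polar K)"
      using \<open>inj (badj h')\<close> by (intro rel_interior_injective_linear_image badj.bounded_linear_right)
    then obtain m where "m \<in> rel_interior (polar K)" "lam = badj h' m" using lam(1) NC by auto
    then show ?thesis using lam(2) by (auto simp: A_eq badj_compose)
  qed
  then obtain m where m: "m \<in> rel_interior (polar K)" "badj A m = xs" by blast
  \<comment> \<open>Membership of \<open>q\<close> in the characteristic subspace gives
    \<open>G' ?z ?v = A (u' + u) + l\<close>. All multipliers of \<open>xs\<close> therefore pair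
    with it to the same value \<open>inner xs (u' + u)\<close>, so the strict multiplier
    \<open>m\<close> also vanishes there and exposes the lineality space.\<close>
  have in_L: "blinfun_apply (G' ?z) ?v \<in> lin_space K"
    if \<mu>: "\<mu> \<in> polar K" "badj A \<mu> = xs" and v: "blinfun_apply (G' ?z) ?v \<in> K" "inner \<mu> (blinfun_apply (G' ?z) ?v) = 0" for \<mu>
  proof -
    have G_fd: "frechet_derivative (h \<circ> g) (at ?z) = blinfun_apply (G' ?z)"
      by (rule frechet_derivative_at[OF G_der[OF zU], symmetric])
    obtain u' l where ul: "blinfun_apply (G' ?z) (q, 0) = blinfun_apply (G' ?z) (0, u') + l" "l \<in> lin_space K"
      using q_in unfolding char_subspace_def set_plus_def Dp_def Dx_def G_fd by auto
    have "?v = (q, 0) + (0, u)" by simp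
    then have v_eq: "blinfun_apply (G' ?z) ?v = blinfun_apply A (u' + u) + l"
      unfolding A_def using ul(1) by (simp only: blinfun.add_right) (simp add: blinfun.add_right[symmetric])
    have pair: "inner \<mu>' (blinfun_apply (G' ?z) ?v) = inner xs (u' + u)" if "\<mu>' \<in> polar K" "badj A \<mu>' = xs" for \<mu>'
      unfolding v_eq inner_add_right[of \<mu>'] using polar_lin_space[OF that(1) ul(2)] that(2) inner_badj[of A \<mu>'] by simp
    have "m \<in> polar K" using m(1) rel_interior_subset by blast
    then have "inner m (blinfun_apply (G' ?z) ?v) = 0" using pair \<mu> m(2) v(2) by simp
    then show ?thesis by (rule rel_interior_polar_exposes_lin_space[OF K m(1) v(1)])
  qed
  have sub1: "graph_deriv (Psi g C) ?z xs ?v \<subseteq> rhs_set g C h ?z xs ?v"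
  proof
    fix w assume "w \<in> graph_deriv (Psi g C) ?z xs ?v"
    from graph_deriv_outer[OF this[unfolded \<Psi>_eq]]
    obtain \<mu> \<eta> where vK: "blinfun_apply (G' ?z) ?v \<in> K" and \<mu>: "\<mu> \<in> polar K" "badj A \<mu> = xs"
      "inner \<mu> (blinfun_apply (G' ?z) ?v) = 0" and \<eta>: "\<And>l. l \<in> lin_space K \<Longrightarrow> inner \<eta> l = 0"
      and w: "w = badj (G2 ?v o\<^sub>L inr_blinfun) \<mu> + badj A \<eta>" by blast
    have vL: "blinfun_apply (G' ?z) ?v \<in> lin_space K" by (rule in_L[OF \<mu>(1,2) vK \<mu>(3)])
    obtain \<epsilon> where \<epsilon>: "\<epsilon> > 0" "m + \<epsilon> *\<^sub>R \<eta> \<in> polar K"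
      using rel_interior_polar_move[OF K m(1) \<eta>] by metis
    define zs where "zs = badj (G' ?z) \<mu>"
    \<comment> \<open>Chosen so that \<open>\<mu> + \<epsilon> *\<^sub>R \<nu> = m + \<epsilon>
      *\<^sub>R \<eta>\<close>. Both \<open>m\<close> and \<open>\<mu>\<close> are multipliers of
      \<open>xs\<close>, so \<open>badj A \<nu> = badj A \<eta>\<close>; on the critical cone
      \<open>\<mu>\<close> vanishes, so \<open>\<nu>\<close> inherits the sign of a polar
      element.\<close>
    define \<nu> where "\<nu> = (m + \<epsilon> *\<^sub>R \<eta> - \<mu>) /\<^sub>R \<epsilon>"
    have snd_zs: "snd zs = xs" using \<mu>(2) by (simp add: zs_def snd_badj A_def)
    have "snd (badj (G' ?z) \<nu>) = badj A \<nu>" by (simp add: snd_badj A_def)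
    also have "\<dots> = badj A \<eta>"
      using \<epsilon>(1) by (simp add: \<nu>_def badj.scaleR_right badj.diff_right badj.add_right m(2) \<mu>(2))
    finally have snd_\<nu>: "snd (badj (G' ?z) \<nu>) = badj A \<eta>" .
    have "zs \<in> normal_cone (tangent_cone {z. g z \<in> C} ?z) ?v"
      unfolding Tan
    proof (rule normal_coneI)
      fix z' assume "z' \<in> {v. blinfun_apply (G' ?z) v \<in> K}"
      then show "inner zs (z' - ?v) \<le> 0"
        using \<mu>(1) \<mu>(3) by (simp add: zs_def inner_diff_right inner_badj polar_def)
    qed (use vK in simp)
    moreover have "badj h' \<mu> \<in> multipliers g C ?z zs"
      using \<mu>(1) by (simp add: multipliers_def NC zs_def G'z badj_compose adj_g)
    moreover have "badj (G' ?z) \<nu> \<in> normal_cone (critical_cone {z. g z \<in> C} ?z zs) ?v"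
    proof (rule normal_coneI)
      show "?v \<in> critical_cone {z. g z \<in> C} ?z zs"
        unfolding critical_cone_def Tan using vK \<mu>(3) by (simp add: zs_def inner_badj)
      fix z' assume "z' \<in> critical_cone {z. g z \<in> C} ?z zs"
      then have z': "blinfun_apply (G' ?z) z' \<in> K" "inner \<mu> (blinfun_apply (G' ?z) z') = 0"
        unfolding critical_cone_def Tan by (simp_all add: zs_def inner_badj)
      have "inner \<nu> (blinfun_apply (G' ?z) ?v) = 0"
        using polar_lin_space[OF \<epsilon>(2) vL] \<mu>(3) by (simp add: \<nu>_def inner_diff_left)
      moreover have "inner \<nu> (blinfun_apply (G' ?z) z') \<le> 0"
      proof -
        have "inner (m + \<epsilon> *\<^sub>R \<eta>) (blinfun_apply (G' ?z) z') \<le> 0" using \<epsilon>(2) z'(1) by (simp add: polar_def)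
        then show ?thesis using \<epsilon>(1) z'(2)
          unfolding \<nu>_def inner_scaleR_left inner_diff_left by (intro mult_nonneg_nonpos) auto
      qed
      ultimately show "inner (badj (G' ?z) \<nu>) (z' - ?v) \<le> 0"
        by (simp add: inner_diff_right inner_badj)
    qed
    moreover have "w = DxT_deriv g ?z (badj h' \<mu>) ?v + H_op g h ?z (badj h' \<mu>) ?v + snd (badj (G' ?z) \<nu>)"
      unfolding deriv_eq snd_\<nu> by (rule w)
    ultimately show "w \<in> rhs_set g C h ?z xs ?v"
      unfolding rhs_set_def using snd_zs by blast
  qed
  have d2_g: "d2 g ?z ?v ?v = blinfun_apply (g2 ?v) ?v"
  proof -
    have "((\<lambda>z. blinfun_apply (Dbl g z) ?v) has_derivative (\<lambda>w. blinfun_apply (g2 w) ?v)) (at ?z)"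
      by (rule bounded_linear.has_derivative[OF blinfun.bounded_linear_left Ug(4)])
    then have "frechet_derivative (\<lambda>z. frechet_derivative g (at z) ?v) (at ?z) = (\<lambda>w. blinfun_apply (g2 w) ?v)"
      by (rule frechet_derivative_on_open[OF Ug(1,2)]) (simp add: frechet_derivative_Dbl[OF Ug(3)])
    then show ?thesis by (simp add: d2_def)
  qed
  have d2_h: "d2 h ?y a a = blinfun_apply (h2 a) a" for a
  proof -
    have "((\<lambda>z. blinfun_apply (Dbl h z) a) has_derivative (\<lambda>w. blinfun_apply (h2 w) a)) (at ?y)"
      by (rule bounded_linear.has_derivative[OF blinfun.bounded_linear_left Uh(4)])
    then have "frechet_derivative (\<lambda>z. frechet_derivative h (at z) a) (at ?y) = (\<lambda>w. blinfun_apply (h2 w) a)"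
      by (rule frechet_derivative_on_open[OF Uh(1,2)]) (simp add: frechet_derivative_Dbl[OF Uh(3)])
    then show ?thesis by (simp add: d2_def)
  qed
  \<comment> \<open>The left side of the second-order condition is the second derivative of
    \<open>h \<circ> g\<close> along \<open>v\<close>, so the condition supplies exactly the
    splitting that \<open>graph_deriv_inner\<close> requires.\<close>
  have soc: "second_order_cond g h K ?z ?v \<longleftrightarrow>
      blinfun_apply (G2 ?v) ?v \<in> set_plus (range (blinfun_apply (G' ?z))) (lin_space K)"
    unfolding second_order_cond_def d2_g d2_h G2_def G'z
    by (simp add: blinfun.bilinear_simps d2_h add.commute blinfun_compose.rep_eq)
  have sub2: "rhs_set g C h ?z xs ?v \<subseteq> graph_deriv (Psi g C) ?z xs ?v" if soc_v: "second_order_cond g h K ?z ?v"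
  proof
    fix w assume "w \<in> rhs_set g C h ?z xs ?v"
    then obtain zs lam n where zs: "zs \<in> normal_cone (tangent_cone {z. g z \<in> C} ?z) ?v" "snd zs = xs"
      and lam: "lam \<in> multipliers g C ?z zs"
      and n: "n \<in> normal_cone (critical_cone {z. g z \<in> C} ?z zs) ?v"
      and w: "w = DxT_deriv g ?z lam ?v + H_op g h ?z lam ?v + snd n"
      unfolding rhs_set_def by blast
    obtain \<mu> where \<mu>: "\<mu> \<in> polar K" "lam = badj h' \<mu>" "zs = badj (G' ?z) \<mu>"
      using lam by (auto simp: multipliers_def NC G'z badj_compose adj_g)
    have A\<mu>: "badj A \<mu> = xs" using zs(2) \<mu>(3) by (simp add: snd_badj A_def)
    have crit: "critical_cone {z. g z \<in> C} ?z zs = {v. blinfun_apply (G' ?z) v \<in> K \<and> inner \<mu> (blinfun_apply (G' ?z) v) = 0}"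
      by (auto simp: critical_cone_def Tan \<mu>(3) inner_badj)
    have vK: "blinfun_apply (G' ?z) ?v \<in> K" "inner \<mu> (blinfun_apply (G' ?z) ?v) = 0"
      using normal_cone_mem[OF n] by (auto simp: crit)
    have vL: "blinfun_apply (G' ?z) ?v \<in> lin_space K" by (rule in_L[OF \<mu>(1) A\<mu> vK])
    have subL: "subspace (lin_space K)" by (rule subspace_lin_space[OF K(2-4)])
    \<comment> \<open>Both \<open>G' ?z ?v\<close> and \<open>A a\<close> lie in the lineality
      space, so the whole ray in direction \<open>(0, a)\<close> stays in the critical cone.
      Applying this to \<open>- a\<close> as well shows that \<open>snd n\<close> annihilates these
      directions.\<close>
    have le: "inner (snd n) a \<le> 0" if a: "blinfun_apply A a \<in> lin_space K" for a
    proof -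
      have "inner n (0, a) \<le> 0"
      proof (rule normal_cone_ray[OF n])
        fix s :: real
        have "blinfun_apply (G' ?z) (?v + s *\<^sub>R (0, a)) = blinfun_apply (G' ?z) ?v + s *\<^sub>R blinfun_apply A a"
          by (simp only: blinfun.add_right blinfun.scaleR_right) (simp add: A_def)
        moreover have "\<dots> \<in> lin_space K" by (intro subspace_add subspace_scale subL vL a)
        ultimately have "blinfun_apply (G' ?z) (?v + s *\<^sub>R (0, a)) \<in> lin_space K" by (simp only:)
        then show "?v + s *\<^sub>R (0, a) \<in> critical_cone {z. g z \<in> C} ?z zs"
          unfolding crit using polar_lin_space[OF \<mu>(1)] by (auto simp: lin_space_def)
      qed
      then show ?thesis by (cases n) simp
    qed
    have "inner (snd n) a = 0" if a: "blinfun_apply A a \<in> lin_space K" for a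
      using le[OF a] le[of "- a"] subspace_neg[OF subL a] by (simp add: blinfun.minus_right)
    then obtain \<eta> where \<eta>: "\<And>l. l \<in> lin_space K \<Longrightarrow> inner \<eta> l = 0" "snd n = badj A \<eta>"
      using badj_image_orthogonal[OF subL, of A "snd n"] by auto
    obtain \<epsilon> where \<epsilon>: "\<epsilon> > 0" "m + \<epsilon> *\<^sub>R \<eta> \<in> polar K"
      using rel_interior_polar_move[OF K m(1) \<eta>(1)] by metis
    \<comment> \<open>The same replacement as in the first inclusion: \<open>\<nu>\<close> gives the
      same vector as \<open>\<eta>\<close> under \<open>badj A\<close>, but is a feasible direction
      of the polar at \<open>\<mu>\<close>.\<close>
    define \<nu> where "\<nu> = (m + \<epsilon> *\<^sub>R \<eta> - \<mu>) /\<^sub>R \<epsilon>"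
    have "badj A \<nu> = badj A \<eta>"
      using \<epsilon>(1) by (simp add: \<nu>_def badj.scaleR_right badj.diff_right badj.add_right m(2) A\<mu>)
    moreover have "\<mu> + \<epsilon> *\<^sub>R \<nu> \<in> polar K" using \<epsilon> by (simp add: \<nu>_def)
    moreover obtain s l where "blinfun_apply (G2 ?v) ?v = blinfun_apply (G' ?z) s + l" "l \<in> lin_space K"
      using soc_v[unfolded soc] unfolding set_plus_def by blast
    ultimately have "badj (G2 ?v o\<^sub>L inr_blinfun) \<mu> + badj A \<eta> \<in> graph_deriv \<Psi> ?z xs ?v"
      using graph_deriv_inner[OF vL _ _ \<mu>(1) A\<mu> \<epsilon>(1), of s l \<nu>] by simp
    then show "w \<in> graph_deriv (Psi g C) ?z xs ?v"
      unfolding \<Psi>_eq w \<mu>(2) deriv_eq \<eta>(2) .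
  qed
  have "second_order_cond g h K ?z ?v" if "surj (frechet_derivative g (at ?z))"
  proof -
    have "surj (blinfun_apply (G' ?z))"
      using that surj_h unfolding G'z blinfun_compose.rep_eq by (intro comp_surj) simp_all
    moreover have "0 \<in> lin_space K" using K0 by (force simp: lin_space_def)
    ultimately show ?thesis unfolding soc set_plus_def by (force simp: surj_def)
  qed
  with sub1 sub2 show ?thesis by blast
qed

end
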